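(* Let $n$ be a positive integer and let $e$ be an idempotent partial transformation of $\{1,\dots,n\}$ such that $|\mathrm{im}(e)|=k\leq n-2$. Let $E=E(\mathcal{PT}_n)$ be the set of idempotents of the monoid $\mathcal{PT}_n$ of all partial transformations of $\{1,\dots,n\}$. Then the maximal subgroup of the free idempotent generated semigroup $\mathsf{IG}(E)$ containing $e$ is isomorphic to the symmetric group $\mathcal{S}_k$.
   Context: $\mathcal{PT}_n$ is the monoid of all partial maps $\alpha$ from $\{1,\dots,n\}$ to itself, under composition from left to right: $x(\alpha\beta)=(x\alpha)\beta$, defined exactly when $x\alpha$ and $(x\alpha)\beta$ are defined. The empty partial map is included. $\mathrm{im}(\alpha)$ denotes the image of $\alpha$. For a semigroup $S$ with set of idempotents $E=E(S)$, a pair $\{e,f\}$ of (not necessarily distinct) elements of $E$ is a basic pair if $\{ef,fe\}\cap\{e,f\}\neq\varnothing$, where the products are taken in $S$; in that case both $ef$ and $fe$ are idempotents of $S$. The free idempotent generated semigroup over $E$ is the semigroup given by the presentation $$\mathsf{IG}(E)=\langle E \mid e\cdot f=ef \text{ for all } e,f\in E \text{ such that } \{e,f\} \text{ is a basic pair}\rangle,$$ where $e\cdot f$ is the two-letter word in the free semigroup $E^+$ and $ef$ is the single letter equal to the product of $e$ and $f$ in $S$. Each $e\in E$ is identified with the idempotent of $\mathsf{IG}(E)$ represented by the generator $e$. The maximal subgroup containing an idempotent $e$ is the $\mathcal{H}$-class of $e$ (with identity element $e$). $\mathcal{S}_k$ is the symmetric group on $k$ points ($\mathcal{S}_0$ is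 the trivial group). *)

theory Defs
  imports "HOL-Algebra.Sym_Groups"
begin

section \<open>Semigroups\<close>

text \<open>
  The record type \<^typ>\<open>'a monoid\<close> carries an identity element, which a semigroup
  such as the one defined by a semigroup presentation need not have.
\<close>

record 'a semigrp = "'a partial_object" +
  sprod :: "['a, 'a] \<Rightarrow> 'a" (infixl \<open>\<cdot>\<index>\<close> 70)

locale semigrp =
  fixes S (structure)
  assumes sprod_closed [simp, intro]:
      "x \<in> carrier S \<Longrightarrow> y \<in> carrier S \<Longrightarrow> x \<cdot> y \<in> carrier S"
    and sprod_assoc:
      "x \<in> carrier S \<Longrightarrow> y \<in> carrier S \<Longrightarrow> z \<in> carrier S \<Longrightarrow> x \<cdot> y \<cdot> z = x \<cdot> (y \<cdot> z)"

definition idempotents :: "('a, 'm) semigrp_scheme \<Rightarrow> 'a set" where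
  "idempotents S = {e \<in> carrier S. e \<cdot>\<^bsub>S\<^esub> e = e}"

text \<open>
  Green's relations. The principal one-sided ideals are formed in \<open>S\<close> with an identity
  adjoined, which accounts for the \<^const>\<open>insert\<close>.
\<close>

definition principal_left_ideal :: "('a, 'm) semigrp_scheme \<Rightarrow> 'a \<Rightarrow> 'a set" where
  "principal_left_ideal S a = insert a {s \<cdot>\<^bsub>S\<^esub> a | s. s \<in> carrier S}"

definition principal_right_ideal :: "('a, 'm) semigrp_scheme \<Rightarrow> 'a \<Rightarrow> 'a set" where
  "principal_right_ideal S a = insert a {a \<cdot>\<^bsub>S\<^esub> s | s. s \<in> carrier S}"

definition green_L :: "('a, 'm) semigrp_scheme \<Rightarrow> 'a \<Rightarrow> 'a \<Rightarrow> bool" where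
  "green_L S a b \<longleftrightarrow> principal_left_ideal S a = principal_left_ideal S b"

definition green_R :: "('a, 'm) semigrp_scheme \<Rightarrow> 'a \<Rightarrow> 'a \<Rightarrow> bool" where
  "green_R S a b \<longleftrightarrow> principal_right_ideal S a = principal_right_ideal S b"

definition H_class :: "('a, 'm) semigrp_scheme \<Rightarrow> 'a \<Rightarrow> 'a set" where
  "H_class S a = {b \<in> carrier S. green_L S a b \<and> green_R S a b}"

definition maximal_subgroup :: "('a, 'm) semigrp_scheme \<Rightarrow> 'a \<Rightarrow> 'a monoid" where
  "maximal_subgroup S e = \<lparr>carrier = H_class S e, mult = sprod S, one = e\<rparr>"

lemma (in semigrp) H_class_idempotent_iff:
  assumes e: "e \<in> idempotents S"
  shows "x \<in> H_class S e \<longleftrightarrow>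
    x \<in> carrier S \<and> e \<cdot> x = x \<and> x \<cdot> e = x \<and>
    (\<exists>s\<in>carrier S. s \<cdot> x = e) \<and> (\<exists>t\<in>carrier S. x \<cdot> t = e)" (is "?l \<longleftrightarrow> ?r")
proof
  have ec: "e \<in> carrier S" and ee: "e \<cdot> e = e"
    using e by (auto simp: idempotents_def)
  {
    assume x: ?l
    then have xc: "x \<in> carrier S"
      and L: "principal_left_ideal S e = principal_left_ideal S x"
      and R: "principal_right_ideal S e = principal_right_ideal S x"
      by (auto simp: H_class_def green_L_def green_R_def)
    have "x \<in> principal_left_ideal S e" "x \<in> principal_right_ideal S e"
      unfolding L R by (auto simp: principal_left_ideal_def principal_right_ideal_def)
    then obtain "x \<cdot> e = x" "e \<cdot> x = x"
      using ec ee unfolding principal_left_ideal_def principal_right_ideal_def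
      by clarsimp (metis sprod_assoc)
    moreover have "e \<in> principal_left_ideal S x" "e \<in> principal_right_ideal S x"
      unfolding L [symmetric] R [symmetric]
      by (auto simp: principal_left_ideal_def principal_right_ideal_def)
    then have "\<exists>s\<in>carrier S. s \<cdot> x = e" "\<exists>t\<in>carrier S. x \<cdot> t = e"
      using ec ee by (auto simp: principal_left_ideal_def principal_right_ideal_def)
    ultimately show ?r using xc by blast
  }
  {
    assume ?r
    then obtain s t where xc: "x \<in> carrier S" and ex: "e \<cdot> x = x" and xe: "x \<cdot> e = x"
      and s: "s \<in> carrier S" "s \<cdot> x = e" and t: "t \<in> carrier S" "x \<cdot> t = e" by blast
    have "principal_left_ideal S e = principal_left_ideal S x"
    proof -
      have "a \<cdot> e \<in> principal_left_ideal S x" if "a \<in> carrier S" for a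
        using that s xc sprod_assoc [of a s x]
        by (auto simp: principal_left_ideal_def intro!: exI [of _ "a \<cdot> s"])
      moreover have "a \<cdot> x \<in> principal_left_ideal S e" if "a \<in> carrier S" for a
        using that xe xc ec sprod_assoc [of a x e]
        by (auto simp: principal_left_ideal_def intro!: exI [of _ "a \<cdot> x"])
      ultimately show ?thesis using s xe ec xc ee unfolding principal_left_ideal_def
        by auto metis+
    qed
    moreover have "principal_right_ideal S e = principal_right_ideal S x"
    proof -
      have "e \<cdot> a \<in> principal_right_ideal S x" if "a \<in> carrier S" for a
        using that t xc sprod_assoc [of x t a]
        by (auto simp: principal_right_ideal_def intro!: exI [of _ "t \<cdot> a"])
      moreover have "x \<cdot> a \<in> principal_right_ideal S e" if "a \<in> carrier S" for a
        using that ex xc ec sprod_assoc [of e x a]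
        by (auto simp: principal_right_ideal_def intro!: exI [of _ "x \<cdot> a"])
      ultimately show ?thesis using t ex ec xc ee unfolding principal_right_ideal_def
        by auto metis+
    qed
    ultimately show ?l using xc by (simp add: H_class_def green_L_def green_R_def)
  }
qed

lemma (in semigrp) group_maximal_subgroup:
  assumes e: "e \<in> idempotents S"
  shows "group (maximal_subgroup S e)"
proof -
  note iff = H_class_idempotent_iff [OF e]
  have ec: "e \<in> carrier S" and ee: "e \<cdot> e = e"
    using e by (auto simp: idempotents_def)
  show ?thesis
  proof (rule groupI; simp add: maximal_subgroup_def)
    fix x y assume x: "x \<in> H_class S e" and y: "y \<in> H_class S e"
    obtain s t where s: "s \<in> carrier S" "s \<cdot> x = e" and t: "t \<in> carrier S" "x \<cdot> t = e"
      using x iff by blast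
    obtain s' t' where s': "s' \<in> carrier S" "s' \<cdot> y = e" and t': "t' \<in> carrier S" "y \<cdot> t' = e"
      using y iff by blast
    have c: "x \<in> carrier S" "y \<in> carrier S" and ex: "e \<cdot> x = x" "x \<cdot> e = x" "e \<cdot> y = y" "y \<cdot> e = y"
      using x y iff by blast+
    have "(s' \<cdot> s) \<cdot> (x \<cdot> y) = s' \<cdot> ((s \<cdot> x) \<cdot> y)"
      using c s(1) s'(1) by (simp add: sprod_assoc)
    also have "\<dots> = e" using s s' ex by simp
    finally have 1: "(s' \<cdot> s) \<cdot> (x \<cdot> y) = e" .
    have "(x \<cdot> y) \<cdot> (t' \<cdot> t) = x \<cdot> ((y \<cdot> t') \<cdot> t)"
      using c t(1) t'(1) by (simp add: sprod_assoc)
    also have "\<dots> = (x \<cdot> e) \<cdot> t" using c t t' ec by (simp add: sprod_assoc)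
    also have "\<dots> = e" using ex t by simp
    finally have 2: "(x \<cdot> y) \<cdot> (t' \<cdot> t) = e" .
    show "x \<cdot> y \<in> H_class S e"
      unfolding iff
    proof (intro conjI)
      show "e \<cdot> (x \<cdot> y) = x \<cdot> y" using c ec ex by (metis sprod_assoc)
      show "x \<cdot> y \<cdot> e = x \<cdot> y" using c ec ex by (metis sprod_assoc)
    qed (use 1 2 c s s' t t' in blast)+
  next
    show "e \<in> H_class S e" unfolding iff using ec ee by blast
  next
    fix x y z assume "x \<in> H_class S e" "y \<in> H_class S e" "z \<in> H_class S e"
    then show "x \<cdot> y \<cdot> z = x \<cdot> (y \<cdot> z)" using iff sprod_assoc by blast
  next
    fix x assume "x \<in> H_class S e"
    then show "e \<cdot> x = x" using iff by blast
  next
    fix x assume x: "x \<in> H_class S e"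
    then obtain s t where xc: "x \<in> carrier S" and ex: "e \<cdot> x = x" "x \<cdot> e = x"
      and s: "s \<in> carrier S" "s \<cdot> x = e" and t: "t \<in> carrier S" "x \<cdot> t = e"
      using iff by blast
    define y where "y = e \<cdot> s \<cdot> e"
    have yc: "y \<in> carrier S" and ey: "e \<cdot> y = y" "y \<cdot> e = y"
      using ec ee s by (metis y_def sprod_assoc sprod_closed)+
    have yx: "y \<cdot> x = e" using ec ee s ex xc by (simp add: y_def sprod_assoc)
    have st: "s \<cdot> e = e \<cdot> t" using s t xc sprod_assoc [of s x t] by simp
    have "y = e \<cdot> t" using st ec ee s t by (metis y_def sprod_assoc)
    then have "x \<cdot> y = e" using xc ec t ex sprod_assoc [of x e t] by simp
    then have "y \<in> H_class S e" unfolding iff using yc ey yx xc by blast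
    then show "\<exists>y\<in>H_class S e. y \<cdot> x = e" using yx by blast
  qed
qed


section \<open>Semigroup presentations\<close>

definition free_semigrp_words :: "'a set \<Rightarrow> 'a list set" where
  "free_semigrp_words A = {w \<in> lists A. w \<noteq> []}"

inductive_set presentation_cong :: "'a set \<Rightarrow> ('a list \<times> 'a list) set \<Rightarrow> ('a list \<times> 'a list) set"
  for A :: "'a set" and R :: "('a list \<times> 'a list) set" where
  relation: "(u, v) \<in> R \<Longrightarrow> (u, v) \<in> presentation_cong A R"
| refl: "w \<in> free_semigrp_words A \<Longrightarrow> (w, w) \<in> presentation_cong A R"
| sym: "(u, v) \<in> presentation_cong A R \<Longrightarrow> (v, u) \<in> presentation_cong A R"
| trans: "(u, v) \<in> presentation_cong A R \<Longrightarrow> (v, w) \<in> presentation_cong A R \<Longrightarrow>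
    (u, w) \<in> presentation_cong A R"
| append: "(u, v) \<in> presentation_cong A R \<Longrightarrow> (u', v') \<in> presentation_cong A R \<Longrightarrow>
    (u @ u', v @ v') \<in> presentation_cong A R"

definition presented_semigrp :: "'a set \<Rightarrow> ('a list \<times> 'a list) set \<Rightarrow> 'a list set semigrp" where
  "presented_semigrp A R =
    \<lparr>carrier = free_semigrp_words A // presentation_cong A R,
     sprod = (\<lambda>X Y. \<Union>u\<in>X. \<Union>v\<in>Y. presentation_cong A R `` {u @ v})\<rparr>"

lemma equiv_presentation_cong:
  assumes "R \<subseteq> free_semigrp_words A \<times> free_semigrp_words A"
  shows "equiv (free_semigrp_words A) (presentation_cong A R)"
proof (rule equivI)
  have "u \<in> free_semigrp_words A \<and> v \<in> free_semigrp_words A"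
    if "(u, v) \<in> presentation_cong A R" for u v
    using that by induction (use assms in \<open>auto simp: free_semigrp_words_def\<close>)
  then show "presentation_cong A R \<subseteq> free_semigrp_words A \<times> free_semigrp_words A" by auto
  show "refl_on (free_semigrp_words A) (presentation_cong A R)"
    by (auto intro: refl_onI presentation_cong.refl)
  show "Relation.sym (presentation_cong A R)"
    by (auto intro: symI presentation_cong.sym)
  show "Relation.trans (presentation_cong A R)"
    by (auto intro: transI presentation_cong.trans)
qed

lemma presented_semigrp_sprod_class:
  assumes "R \<subseteq> free_semigrp_words A \<times> free_semigrp_words A"
    and "u \<in> free_semigrp_words A" "v \<in> free_semigrp_words A"
  shows "(presentation_cong A R `` {u}) \<cdot>\<^bsub>presented_semigrp A R\<^esub> (presentation_cong A R `` {v})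
    = presentation_cong A R `` {u @ v}"
  using assms(2,3)
  by (auto simp: presented_semigrp_def
      intro: presentation_cong.intros)

lemma semigrp_presented_semigrp:
  assumes R: "R \<subseteq> free_semigrp_words A \<times> free_semigrp_words A"
  shows "semigrp (presented_semigrp A R)"
proof
  have app: "u @ v \<in> free_semigrp_words A"
    if "u \<in> free_semigrp_words A" "v \<in> free_semigrp_words A" for u v
    using that by (auto simp: free_semigrp_words_def)
  have car: "carrier (presented_semigrp A R) = free_semigrp_words A // presentation_cong A R"
    by (simp add: presented_semigrp_def)
  note cl = presented_semigrp_sprod_class [OF R]
  fix x y assume x: "x \<in> carrier (presented_semigrp A R)" and y: "y \<in> carrier (presented_semigrp A R)"
  obtain u where u: "u \<in> free_semigrp_words A" "x = presentation_cong A R `` {u}"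
    using x unfolding car by (rule quotientE)
  obtain v where v: "v \<in> free_semigrp_words A" "y = presentation_cong A R `` {v}"
    using y unfolding car by (rule quotientE)
  show "x \<cdot>\<^bsub>presented_semigrp A R\<^esub> y \<in> carrier (presented_semigrp A R)"
    using u v app cl car by (simp add: quotientI)
  fix z assume z: "z \<in> carrier (presented_semigrp A R)"
  obtain w where w: "w \<in> free_semigrp_words A" "z = presentation_cong A R `` {w}"
    using z unfolding car by (rule quotientE)
  show "x \<cdot>\<^bsub>presented_semigrp A R\<^esub> y \<cdot>\<^bsub>presented_semigrp A R\<^esub> z =
      x \<cdot>\<^bsub>presented_semigrp A R\<^esub> (y \<cdot>\<^bsub>presented_semigrp A R\<^esub> z)"
    using u v w app cl by simp
qed


section \<open>The free idempotent generated semigroup\<close>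

definition basic_pair :: "('a, 'm) semigrp_scheme \<Rightarrow> 'a \<Rightarrow> 'a \<Rightarrow> bool" where
  "basic_pair S e f \<longleftrightarrow>
    e \<in> idempotents S \<and> f \<in> idempotents S \<and> {e \<cdot>\<^bsub>S\<^esub> f, f \<cdot>\<^bsub>S\<^esub> e} \<inter> {e, f} \<noteq> {}"

definition IG_relations :: "('a, 'm) semigrp_scheme \<Rightarrow> ('a list \<times> 'a list) set" where
  "IG_relations S = {([e, f], [e \<cdot>\<^bsub>S\<^esub> f]) | e f. basic_pair S e f}"

text \<open>
  \<open>IG S\<close> is the semigroup usually written \<open>IG(E)\<close> for \<open>E = E(S)\<close>, the
  biordered structure of \<open>E\<close> being read off from \<open>S\<close>.
\<close>

definition IG :: "('a, 'm) semigrp_scheme \<Rightarrow> 'a list set semigrp" where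
  "IG S = presented_semigrp (idempotents S) (IG_relations S)"

definition IG_gen :: "('a, 'm) semigrp_scheme \<Rightarrow> 'a \<Rightarrow> 'a list set" where
  "IG_gen S e = presentation_cong (idempotents S) (IG_relations S) `` {[e]}"

lemma (in semigrp) basic_pair_sprod_idempotent:
  assumes "basic_pair S e f"
  shows "e \<cdot> f \<in> idempotents S" "f \<cdot> e \<in> idempotents S"
proof -
  have c: "e \<in> carrier S" "f \<in> carrier S" and i: "e \<cdot> e = e" "f \<cdot> f = f"
    and "e \<cdot> f = e \<or> e \<cdot> f = f \<or> f \<cdot> e = e \<or> f \<cdot> e = f"
    using assms by (auto simp: basic_pair_def idempotents_def)
  then have "(e \<cdot> f) \<cdot> (e \<cdot> f) = e \<cdot> f \<and> (f \<cdot> e) \<cdot> (f \<cdot> e) = f \<cdot> e"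
    by (metis sprod_assoc sprod_closed)
  then show "e \<cdot> f \<in> idempotents S" "f \<cdot> e \<in> idempotents S"
    using c by (auto simp: idempotents_def)
qed

lemma (in semigrp) IG_relations_subset:
  "IG_relations S \<subseteq> free_semigrp_words (idempotents S) \<times> free_semigrp_words (idempotents S)"
  using basic_pair_sprod_idempotent
  by (auto simp: IG_relations_def free_semigrp_words_def basic_pair_def)

lemma (in semigrp) semigrp_IG: "semigrp (IG S)"
  unfolding IG_def by (rule semigrp_presented_semigrp [OF IG_relations_subset])

lemma (in semigrp) IG_gen_idempotent:
  assumes e: "e \<in> idempotents S"
  shows "IG_gen S e \<in> idempotents (IG S)"
proof -
  let ?c = "presentation_cong (idempotents S) (IG_relations S)"
  have w: "[e] \<in> free_semigrp_words (idempotents S)"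
    using e by (simp add: free_semigrp_words_def)
  have ee: "e \<cdot> e = e" using e by (simp add: idempotents_def)
  have "basic_pair S e e" using e ee by (simp add: basic_pair_def)
  then have "([e, e], [e]) \<in> IG_relations S"
    using ee by (force simp: IG_relations_def)
  then have "([e, e], [e]) \<in> ?c" by (rule presentation_cong.relation)
  then have "?c `` {[e, e]} = ?c `` {[e]}"
    by (rule equiv_class_eq [OF equiv_presentation_cong [OF IG_relations_subset]])
  then have "IG_gen S e \<cdot>\<^bsub>IG S\<^esub> IG_gen S e = IG_gen S e"
    using presented_semigrp_sprod_class [OF IG_relations_subset w w]
    by (simp add: IG_def IG_gen_def)
  moreover have "IG_gen S e \<in> carrier (IG S)"
    using w by (simp add: IG_def IG_gen_def presented_semigrp_def quotientI)
  ultimately show ?thesis by (simp add: idempotents_def)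
qed


section \<open>Partial transformations\<close>

text \<open>
  Maps act on the right and compose from left to right, so the product of \<open>\<alpha>\<close> and
  \<open>\<beta>\<close> applies \<open>\<alpha>\<close> first, whereas \<^const>\<open>map_comp\<close> applies its right argument first.
\<close>

definition PT :: "nat \<Rightarrow> (nat \<rightharpoonup> nat) semigrp" where
  "PT n = \<lparr>carrier = {\<alpha>. dom \<alpha> \<subseteq> {1..n} \<and> ran \<alpha> \<subseteq> {1..n}},
           sprod = (\<lambda>\<alpha> \<beta>. \<beta> \<circ>\<^sub>m \<alpha>)\<rparr>"

lemma semigrp_PT: "semigrp (PT n)"
proof
  fix \<alpha> \<beta> assume "\<alpha> \<in> carrier (PT n)" "\<beta> \<in> carrier (PT n)"
  then show "\<alpha> \<cdot>\<^bsub>PT n\<^esub> \<beta> \<in> carrier (PT n)"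
    by (fastforce simp: PT_def dom_def ran_def map_comp_Some_iff)
next
  fix \<alpha> \<beta> \<gamma>
  show "\<alpha> \<cdot>\<^bsub>PT n\<^esub> \<beta> \<cdot>\<^bsub>PT n\<^esub> \<gamma> = \<alpha> \<cdot>\<^bsub>PT n\<^esub> (\<beta> \<cdot>\<^bsub>PT n\<^esub> \<gamma>)"
    by (auto simp: PT_def map_comp_def split: option.splits)
qed

end

theory Submission
  imports Defs
begin

text \<open>
  Evaluating words in \<open>PT n\<close> maps the maximal subgroup at \<open>e\<close> into the permutations of the
  image of \<open>e\<close>. The content of the theorem is that this map is injective: an element of the
  \<open>R\<close>-class of \<open>e\<close> in the free idempotent generated semigroup is determined by where it sends the
  \<open>k\<close> points of the image. Read each such element as a placement of \<open>k\<close> distinguishable tokens on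
  the points \<open>1, \<dots>, n\<close>. Right multiplication by an idempotent of \<open>PT n\<close> either destroys the
  \<open>R\<close>-class or moves the tokens, and every such movement is a product of single steps, each of which
  moves one token to an unoccupied point. A step is realised by the idempotent that collapses the
  old point of the token onto the new one and fixes every other point.

  What has to be shown is that the result of a sequence of steps depends only on the final placement.
  The defining relations of the semigroup make two kinds of steps coherent: moving one token twice is
  the same as moving it once, and steps of two different tokens that do not obstruct each other
  commute. The reason is that, on the right of an element supported by the occupied points, a
  collapsing idempotent \<open>g\<close> may be replaced by \<open>pg\<close> for any retraction \<open>p\<close> onto these points with
  \<open>gp = p\<close>, and a single \<open>p\<close> serves all the steps in question (lemma \<open>local_system_supported\<close>).

  These two coherence rules suffice, because the complex whose vertices are the placements, whose
  edges are the steps and whose two-cells are the triangles and squares above is simply connected as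
  soon as there are two unoccupied points. This is an induction on the number of tokens
  (lemma \<open>local_system_section\<close>): forgetting one token is a projection whose fibres are complete
  graphs, and each step, triangle or square of the remaining tokens can be lifted by parking the
  forgotten token on a point that is not involved, for which the \<open>k + 2 \<le> n\<close> of the theorem leaves
  just enough room. In the language of coverings, a local system on this complex has a section
  through every point.

  Such a section \<open>t\<close> with value \<open>e\<close> at the initial placement satisfies \<open>t a \<cdot> w = t (a w)\<close> for every
  \<open>w\<close> whose value in \<open>PT n\<close> is defined and injective on the points of \<open>a\<close> (lemma \<open>section_mult\<close>).
  Hence the elements of the maximal subgroup are the values of \<open>t\<close> at the \<open>k!\<close> rearrangements of the
  initial placement, and they multiply like permutations.
\<close>

section \<open>Token placements\<close>

text \<open>
  A list \<open>a\<close> places token number \<open>i\<close> at the point \<open>a ! i\<close>. The step that moves token \<open>i\<close> to \<open>x\<close> is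
  legal precisely if \<open>a[i := x]\<close> is again a placement; this includes the case \<open>x = a ! i\<close>.
\<close>

definition placements :: "nat \<Rightarrow> nat \<Rightarrow> nat list set" where
  "placements n k = {a. distinct a \<and> length a = k \<and> set a \<subseteq> {1..n}}"

lemma placements_Cons:
  "z # a \<in> placements n (Suc k) \<longleftrightarrow> a \<in> placements n k \<and> z \<in> {1..n} \<and> z \<notin> set a"
  by (auto simp: placements_def)

lemma placements_SucE:
  assumes "b \<in> placements n (Suc k)"
  obtains z a where "b = z # a" "a \<in> placements n k" "z \<in> {1..n}" "z \<notin> set a"
  using assms by (cases b) (auto simp: placements_def)

lemma unoccupied_place_exists:
  assumes "finite A" "card A < n"
  shows "\<exists>z. z \<in> {1..n} \<and> z \<notin> A"
proof (rule ccontr)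
  assume "\<not> ?thesis"
  then have "{1..n} \<subseteq> A" by auto
  then have "n \<le> card A" using card_mono [OF assms(1), of "{1..n}"] by simp
  then show False using assms(2) by simp
qed

definition spare :: "nat \<Rightarrow> nat set \<Rightarrow> nat" where
  "spare n A = (SOME z. z \<in> {1..n} \<and> z \<notin> A)"

lemma spare:
  assumes "finite A" "card A < n"
  shows "spare n A \<in> {1..n}" "spare n A \<notin> A"
  using someI_ex [OF unoccupied_place_exists [OF assms]] unfolding spare_def by auto

lemma card_set_placement: "a \<in> placements n k \<Longrightarrow> card (set a) = k"
  by (auto simp: placements_def distinct_card)

lemma spare_placement:
  assumes "a \<in> placements n k" "k < n"
  shows "spare n (set a) # a \<in> placements n (Suc k)"
  using spare [of "set a" n] assms card_set_placement [OF assms(1)] by (simp add: placements_Cons)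

lemma card_insert_placement_le:
  assumes "a \<in> placements n k"
  shows "card (insert x (set a)) \<le> Suc k" "card (insert x (insert y (set a))) \<le> Suc (Suc k)"
proof -
  show 1: "card (insert x (set a)) \<le> Suc k" for x
    using card_set_placement [OF assms] card_insert_le_m1 [of "Suc k" "set a" x] by simp
  show "card (insert x (insert y (set a))) \<le> Suc (Suc k)"
    using card_insert_le_m1 [of "Suc (Suc k)" "insert y (set a)" x] 1 [of y] by simp
qed

text \<open>
  One unoccupied point suffices to reach every placement from every other. By induction on the
  number of tokens: for a set of placements that is closed under steps, membership of \<open>z # a\<close> does not
  depend on \<open>z\<close>, since the first token may jump between any two points that \<open>a\<close> leaves free. So the
  set is the preimage of a set of placements of the other tokens, and the latter is closed under
  steps because the first token can get out of the way.
\<close>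

lemma placements_connected:
  assumes "k < n" "a \<in> placements n k" "Q a" "b \<in> placements n k"
    and move: "\<And>a i x. a \<in> placements n k \<Longrightarrow> i < k \<Longrightarrow> a[i := x] \<in> placements n k \<Longrightarrow>
      Q a \<Longrightarrow> Q (a[i := x])"
  shows "Q b"
  using assms
proof (induction k arbitrary: a b Q)
  case 0
  then show ?case by (simp add: placements_def)
next
  case (Suc k)
  define Q' where "Q' a \<longleftrightarrow> (\<forall>z\<in>{1..n}. z \<notin> set a \<longrightarrow> Q (z # a))" for a
  have fibre: "Q (y # c)"
    if "c \<in> placements n k" "y \<in> {1..n}" "y \<notin> set c" "z \<in> {1..n}" "z \<notin> set c" "Q (z # c)" for c y z
    using that Suc.prems(5) [of "z # c" 0 y] by (simp add: placements_Cons)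
  obtain z a' where a: "a = z # a'" "a' \<in> placements n k" "z \<in> {1..n}" "z \<notin> set a'"
    using Suc.prems(2) by (rule placements_SucE)
  obtain y b' where b: "b = y # b'" "b' \<in> placements n k" "y \<in> {1..n}" "y \<notin> set b'"
    using Suc.prems(4) by (rule placements_SucE)
  have "Q' b'"
  proof (rule Suc.IH)
    show "Q' a'" using fibre Suc.prems(3) a by (auto simp: Q'_def)
    fix c i x
    assume c: "c \<in> placements n k" "i < k" "c[i := x] \<in> placements n k" "Q' c"
    show "Q' (c[i := x])"
      unfolding Q'_def
    proof (intro ballI impI)
      fix w assume w: "w \<in> {1..n}" "w \<notin> set (c[i := x])"
      obtain z where z: "z \<in> {1..n}" "z \<notin> insert x (set c)"
        using unoccupied_place_exists [of "insert x (set c)" n]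
          card_insert_placement_le(1) [OF c(1), of x] Suc.prems(1) by auto
      then have z': "z \<notin> set (c[i := x])" using set_update_subset_insert [of c i x] by auto
      have "Q ((z # c)[Suc i := x])"
        by (rule Suc.prems(5)) (use c z z' in \<open>auto simp: placements_Cons Q'_def\<close>)
      then show "Q (w # c[i := x])" using fibre [OF c(3) w z(1) z'] by simp
    qed
  qed (use Suc.prems a b in auto)
  then show ?case using b by (simp add: Q'_def)
qed

section \<open>Local systems on placements\<close>

text \<open>
  A covering of the complex of placements: its triangles arise from moving one token twice, its
  squares from moving two tokens independently. The maps along the steps are bijections because, by
  \<open>move_move\<close> and \<open>move_stay\<close>, a step is undone by the step back.
\<close>

locale local_system =
  fixes n k :: nat and X :: "nat list \<Rightarrow> 'x set" and m :: "nat list \<Rightarrow> nat \<Rightarrow> nat \<Rightarrow> 'x \<Rightarrow> 'x"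
  assumes move_closed: "\<lbrakk>a \<in> placements n k; i < k; a[i := x] \<in> placements n k; u \<in> X a\<rbrakk> \<Longrightarrow>
      m a i x u \<in> X (a[i := x])"
    and move_stay: "\<lbrakk>a \<in> placements n k; i < k; u \<in> X a\<rbrakk> \<Longrightarrow> m a i (a ! i) u = u"
    and move_move: "\<lbrakk>a \<in> placements n k; i < k; a[i := x] \<in> placements n k;
      a[i := y] \<in> placements n k; u \<in> X a\<rbrakk> \<Longrightarrow> m (a[i := x]) i y (m a i x u) = m a i y u"
    and move_commute: "\<lbrakk>a \<in> placements n k; i < k; j < k; i \<noteq> j; a[i := x] \<in> placements n k;
      a[j := y] \<in> placements n k; a[i := x, j := y] \<in> placements n k; u \<in> X a\<rbrakk> \<Longrightarrow>
      m (a[i := x]) j y (m a i x u) = m (a[j := y]) i x (m a j y u)"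

text \<open>
  Over \<open>n\<close> points, a local system for \<open>k + 1\<close> tokens induces one for \<open>k\<close> tokens. Since the first
  token moves freely between the points that \<open>a\<close> leaves free, the sets over all placements \<open>z # a\<close>
  are identified, and the set over \<open>z # a\<close> for one chosen \<open>z\<close>, here \<open>spare n (set a)\<close>, may serve as
  the set over \<open>a\<close>. To lift a step of the other tokens, the first token is parked at a point \<open>z\<close>
  that does not obstruct this step, and brought to its standard position afterwards.
\<close>

definition fibre_move ::
  "nat \<Rightarrow> (nat list \<Rightarrow> nat \<Rightarrow> nat \<Rightarrow> 'x \<Rightarrow> 'x) \<Rightarrow> nat \<Rightarrow> nat list \<Rightarrow> nat \<Rightarrow> nat \<Rightarrow> 'x \<Rightarrow> 'x" where
  "fibre_move n m z a i x u =
    m (z # a[i := x]) 0 (spare n (set (a[i := x])))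
      (m (z # a) (Suc i) x (m (spare n (set a) # a) 0 z u))"

definition push_move ::
  "nat \<Rightarrow> (nat list \<Rightarrow> nat \<Rightarrow> nat \<Rightarrow> 'x \<Rightarrow> 'x) \<Rightarrow> nat list \<Rightarrow> nat \<Rightarrow> nat \<Rightarrow> 'x \<Rightarrow> 'x" where
  "push_move n m a i x = fibre_move n m (spare n (insert x (set a))) a i x"

text \<open>
  The parking point \<open>z\<close> is irrelevant: going from \<open>w\<close> to \<open>z\<close> commutes with the step of the other
  token when neither point is involved in it. Being free to choose \<open>z\<close> is what allows a whole triangle
  or square to be lifted with the first token standing still.
\<close>

lemma
  assumes "local_system n (Suc k) X m" and "Suc k < n"
    and a: "a \<in> placements n k" and i: "i < k" and ax: "a[i := x] \<in> placements n k"
    and u: "u \<in> X (spare n (set a) # a)"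
    and z: "z \<in> {1..n}" "z \<noteq> x" "z \<notin> set a"
  shows fibre_move_closed: "fibre_move n m z a i x u \<in> X (spare n (set (a[i := x])) # a[i := x])"
    and lift_fibre_move: "m (spare n (set (a[i := x])) # a[i := x]) 0 z (fibre_move n m z a i x u) =
      m (z # a) (Suc i) x (m (spare n (set a) # a) 0 z u)"
    and push_move_eq_fibre_move: "push_move n m a i x u = fibre_move n m z a i x u"
proof -
  interpret local_system n "Suc k" X m by fact
  have ka: "k < n" using assms(2) by simp
  let ?s = "spare n (set a)" and ?s' = "spare n (set (a[i := x]))"
  have sa: "?s # a \<in> placements n (Suc k)" using spare_placement [OF a ka] .
  have sax: "?s' # a[i := x] \<in> placements n (Suc k)" using spare_placement [OF ax ka] .
  have pl: "w # a \<in> placements n (Suc k)" "w # a[i := x] \<in> placements n (Suc k)"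
    if "w \<in> {1..n}" "w \<noteq> x" "w \<notin> set a" for w
    using that a ax set_update_subset_insert [of a i x] by (auto simp: placements_Cons)
  have v1: "m (?s # a) 0 w u \<in> X (w # a)" if "w \<in> {1..n}" "w \<noteq> x" "w \<notin> set a" for w
    using move_closed [OF sa, of 0 w u] pl that u by simp
  have v2: "m (w # a) (Suc i) x (m (?s # a) 0 w u) \<in> X (w # a[i := x])"
    if "w \<in> {1..n}" "w \<noteq> x" "w \<notin> set a" for w
    using move_closed [OF pl(1) _ _ v1, of w "Suc i" x] pl that i by simp
  have v3: "fibre_move n m w a i x u \<in> X (?s' # a[i := x])"
    if "w \<in> {1..n}" "w \<noteq> x" "w \<notin> set a" for w
    using move_closed [OF pl(2) _ _ v2, of w 0 ?s'] that sax by (simp add: fibre_move_def)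
  show "fibre_move n m z a i x u \<in> X (?s' # a[i := x])" using v3 z by blast
  have l: "m (?s' # a[i := x]) 0 z (fibre_move n m z a i x u) =
      m (z # a[i := x]) 0 z (m (z # a) (Suc i) x (m (?s # a) 0 z u))"
    using move_move [OF pl(2) _ _ _ v2, of z 0 ?s' z] z sax pl by (simp add: fibre_move_def)
  also have "\<dots> = m (z # a) (Suc i) x (m (?s # a) 0 z u)"
    using move_stay [OF pl(2) _ v2, of z 0] z by simp
  finally show "m (?s' # a[i := x]) 0 z (fibre_move n m z a i x u) =
      m (z # a) (Suc i) x (m (?s # a) 0 z u)" .
  \<comment> \<open>the parking point that is used in \<open>push_move\<close>\<close>
  define w where "w = spare n (insert x (set a))"
  have w: "w \<in> {1..n}" "w \<noteq> x" "w \<notin> set a"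
    using spare [of "insert x (set a)" n] card_insert_placement_le(1) [OF a, of x] assms(2)
    by (auto simp: w_def)
  have "fibre_move n m w a i x u = m (z # a[i := x]) 0 ?s'
      (m (w # a[i := x]) 0 z (m (w # a) (Suc i) x (m (?s # a) 0 w u)))"
    using move_move [OF pl(2) _ _ _ v2, of w 0 z ?s'] w z sax pl by (simp add: fibre_move_def)
  also have "m (w # a[i := x]) 0 z (m (w # a) (Suc i) x (m (?s # a) 0 w u)) =
      m (z # a) (Suc i) x (m (w # a) 0 z (m (?s # a) 0 w u))"
    using move_commute [OF pl(1) _ _ _ _ _ _ v1, of w 0 "Suc i" z x] w z pl i by simp
  also have "m (w # a) 0 z (m (?s # a) 0 w u) = m (?s # a) 0 z u"
    using move_move [OF sa, of 0 w z u] w z pl u by simp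
  finally show "push_move n m a i x u = fibre_move n m z a i x u"
    by (simp add: push_move_def w_def fibre_move_def)
qed

text \<open>
  A triangle or a square over a placement of \<open>k\<close> tokens involves two further points. The first token
  must be parked away from all these \<open>k + 2\<close> points, which is why \<open>k + 3\<close> points are required.
\<close>

lemma local_system_push:
  assumes ls: "local_system n (Suc k) X m" and n: "Suc k + 2 \<le> n"
  shows "local_system n k (\<lambda>a. X (spare n (set a) # a)) (push_move n m)"
proof -
  interpret local_system n "Suc k" X m by fact
  have n': "Suc k < n" "k < n" using n by simp_all
  note closed = fibre_move_closed [OF ls n'(1)]
    and lift = lift_fibre_move [OF ls n'(1)]
    and push = push_move_eq_fibre_move [OF ls n'(1)]
  have ex: "\<exists>z. z \<in> {1..n} \<and> z \<noteq> x \<and> z \<noteq> y \<and> z \<notin> set a" if "a \<in> placements n k" for a x y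
    using unoccupied_place_exists [of "insert x (insert y (set a))" n]
      card_insert_placement_le(2) [OF that, of x y] n by auto
  show ?thesis
  proof
    fix a i x u
    assume a: "a \<in> placements n k" "i < k" "a[i := x] \<in> placements n k"
      and u: "u \<in> X (spare n (set a) # a)"
    obtain z where "z \<in> {1..n}" "z \<noteq> x" "z \<notin> set a" using ex [OF a(1)] by blast
    then show "push_move n m a i x u \<in> X (spare n (set (a[i := x])) # a[i := x])"
      using push [OF a u] closed [OF a u] by simp
  next
    fix a i u
    assume a: "a \<in> placements n k" "i < k" and u: "u \<in> X (spare n (set a) # a)"
    have len: "length a = k" using a by (simp add: placements_def)
    obtain z where z: "z \<in> {1..n}" "z \<noteq> a ! i" "z \<notin> set a" using ex [OF a(1)] by blast
    have za: "z # a \<in> placements n (Suc k)" using z a by (simp add: placements_Cons)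
    let ?s = "spare n (set a)"
    have sa: "?s # a \<in> placements n (Suc k)" using spare_placement [OF a(1) n'(2)] .
    have v: "m (?s # a) 0 z u \<in> X (z # a)" using move_closed [OF sa, of 0 z u] za u by simp
    have "push_move n m a i (a ! i) u =
        m (z # a) 0 ?s (m (z # a) (Suc i) (a ! i) (m (?s # a) 0 z u))"
      using push [OF a _ u z] a by (simp add: fibre_move_def)
    also have "\<dots> = m (z # a) 0 ?s (m (?s # a) 0 z u)"
      using move_stay [OF za, of "Suc i"] v a by simp
    also have "\<dots> = m (?s # a) 0 ?s u" using move_move [OF sa, of 0 z ?s u] u za sa by simp
    also have "\<dots> = u" using move_stay [OF sa, of 0 u] u by simp
    finally show "push_move n m a i (a ! i) u = u" .
  next
    fix a i x y u
    assume a: "a \<in> placements n k" "i < k" "a[i := x] \<in> placements n k"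
      and ay: "a[i := y] \<in> placements n k" and u: "u \<in> X (spare n (set a) # a)"
    obtain z where z: "z \<in> {1..n}" "z \<noteq> x" "z \<noteq> y" "z \<notin> set a" using ex [OF a(1)] by blast
    have zx: "z \<notin> set (a[i := x])" using z set_update_subset_insert [of a i x] by auto
    have zy: "z \<notin> set (a[i := y])" using z set_update_subset_insert [of a i y] by auto
    let ?s = "spare n (set a)"
    have sa: "?s # a \<in> placements n (Suc k)" using spare_placement [OF a(1) n'(2)] .
    have za: "z # a \<in> placements n (Suc k)" using z a by (simp add: placements_Cons)
    have v: "m (?s # a) 0 z u \<in> X (z # a)" using move_closed [OF sa, of 0 z u] za u by simp
    have "push_move n m (a[i := x]) i y (push_move n m a i x u) =
        fibre_move n m z (a[i := x]) i y (fibre_move n m z a i x u)"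
      using push [OF a u] push [OF a(3,2)] closed [OF a u] z zx ay by simp
    also have "\<dots> = m (z # a[i := y]) 0 (spare n (set (a[i := y]))) (m (z # a[i := x]) (Suc i) y
        (m (z # a) (Suc i) x (m (?s # a) 0 z u)))"
      using lift [OF a u, of z] z by (simp add: fibre_move_def)
    also have "m (z # a[i := x]) (Suc i) y (m (z # a) (Suc i) x (m (?s # a) 0 z u)) =
        m (z # a) (Suc i) y (m (?s # a) 0 z u)"
      using move_move [OF za, of "Suc i" x y] a ay z zx zy v by (simp add: placements_Cons)
    finally show "push_move n m (a[i := x]) i y (push_move n m a i x u) = push_move n m a i y u"
      using push [OF a(1,2) ay u, of z] z by (simp add: fibre_move_def)
  next
    fix a i j x y u
    assume a: "a \<in> placements n k" and ij: "i < k" "j < k" "i \<noteq> j"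
      and ax: "a[i := x] \<in> placements n k" and ay: "a[j := y] \<in> placements n k"
      and axy: "a[i := x, j := y] \<in> placements n k" and u: "u \<in> X (spare n (set a) # a)"
    have ayx: "a[j := y, i := x] = a[i := x, j := y]" using ij by (simp add: list_update_swap)
    obtain z where z: "z \<in> {1..n}" "z \<noteq> x" "z \<noteq> y" "z \<notin> set a" using ex [OF a] by blast
    have zx: "z \<notin> set (a[i := x])" using z set_update_subset_insert [of a i x] by auto
    have zy: "z \<notin> set (a[j := y])" using z set_update_subset_insert [of a j y] by auto
    have zxy: "z \<notin> set (a[i := x, j := y])" using z zx set_update_subset_insert [of "a[i := x]" j y] by auto
    let ?s = "spare n (set a)"
    have sa: "?s # a \<in> placements n (Suc k)" using spare_placement [OF a n'(2)] .
    have za: "z # a \<in> placements n (Suc k)" using z a by (simp add: placements_Cons)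
    have v: "m (?s # a) 0 z u \<in> X (z # a)" using move_closed [OF sa, of 0 z u] za u by simp
    have "push_move n m (a[i := x]) j y (push_move n m a i x u) =
        fibre_move n m z (a[i := x]) j y (fibre_move n m z a i x u)"
      using push [OF a ij(1) ax u] push [OF ax ij(2) axy] closed [OF a ij(1) ax u] z zx by simp
    also have "\<dots> = m (z # a[i := x, j := y]) 0 (spare n (set (a[i := x, j := y])))
        (m (z # a[i := x]) (Suc j) y (m (z # a) (Suc i) x (m (?s # a) 0 z u)))"
      using lift [OF a ij(1) ax u, of z] z by (simp add: fibre_move_def)
    also have "m (z # a[i := x]) (Suc j) y (m (z # a) (Suc i) x (m (?s # a) 0 z u)) =
        m (z # a[j := y]) (Suc i) x (m (z # a) (Suc j) y (m (?s # a) 0 z u))"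
      using move_commute [OF za, of "Suc i" "Suc j" x y] ij a ax ay axy z zx zy zxy v
      by (simp add: placements_Cons)
    also have "m (z # a[i := x, j := y]) 0 (spare n (set (a[i := x, j := y]))) \<dots> =
        fibre_move n m z (a[j := y]) i x (fibre_move n m z a j y u)"
      using lift [OF a ij(2) ay u, of z] z by (simp add: fibre_move_def ayx)
    also have "\<dots> = push_move n m (a[j := y]) i x (push_move n m a j y u)"
      using push [OF a ij(2) ay u] push [OF ay ij(1)] closed [OF a ij(2) ay u] z zy axy
      by (simp add: ayx)
    finally show "push_move n m (a[i := x]) j y (push_move n m a i x u) =
        push_move n m (a[j := y]) i x (push_move n m a j y u)" .
  qed
qed

definition is_section ::
  "nat \<Rightarrow> nat \<Rightarrow> (nat list \<Rightarrow> 'x set) \<Rightarrow> (nat list \<Rightarrow> nat \<Rightarrow> nat \<Rightarrow> 'x \<Rightarrow> 'x) \<Rightarrow> (nat list \<Rightarrow> 'x) \<Rightarrow> bool" where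
  "is_section n k X m t \<longleftrightarrow> (\<forall>a \<in> placements n k. t a \<in> X a \<and>
    (\<forall>i < k. \<forall>x. a[i := x] \<in> placements n k \<longrightarrow> t (a[i := x]) = m a i x (t a)))"

lemma section_move:
  "\<lbrakk>is_section n k X m t; a \<in> placements n k; i < k; a[i := x] \<in> placements n k\<rbrakk> \<Longrightarrow>
    t (a[i := x]) = m a i x (t a)"
  by (simp add: is_section_def)

text \<open>
  Simple connectedness of the complex of placements. A section of the induced system for one token
  fewer extends over each fibre, because the first token moves between free points in a way that
  is coherent by \<open>move_move\<close>.
\<close>

lemma local_system_section:
  assumes "local_system n k X m" "k + 2 \<le> n" "a \<in> placements n k" "u \<in> X a"
  shows "\<exists>t. is_section n k X m t \<and> t a = u"
  using assms
proof (induction k arbitrary: X m a u)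
  case 0
  then show ?case by (intro exI [of _ "\<lambda>_. u"]) (auto simp: is_section_def placements_def)
next
  case (Suc k)
  note ls = Suc.prems(1) and n = Suc.prems(2)
  interpret local_system n "Suc k" X m by fact
  have n': "Suc k < n" "k < n" using n by simp_all
  obtain z c where a: "a = z # c" "c \<in> placements n k" "z \<in> {1..n}" "z \<notin> set c"
    using Suc.prems(3) by (rule placements_SucE)
  have sc: "spare n (set b) # b \<in> placements n (Suc k)" if "b \<in> placements n k" for b
    using spare_placement [OF that n'(2)] .
  define v where "v = m a 0 (spare n (set c)) u"
  have v: "v \<in> X (spare n (set c) # c)"
    using move_closed [OF Suc.prems(3), of 0 "spare n (set c)" u] Suc.prems(4) sc a by (simp add: v_def)
  obtain t where t: "is_section n k (\<lambda>a. X (spare n (set a) # a)) (push_move n m) t" "t c = v"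
    using Suc.IH [OF local_system_push [OF ls n] _ a(2) v] n by auto
  have tX: "t b \<in> X (spare n (set b) # b)" if "b \<in> placements n k" for b
    using t(1) that by (simp add: is_section_def)
  have tm: "t (b[i := x]) = push_move n m b i x (t b)"
    if "b \<in> placements n k" "i < k" "b[i := x] \<in> placements n k" for b i x
    using t(1) that by (simp add: is_section_def)
  define t' where "t' b = m (spare n (set (tl b)) # tl b) 0 (hd b) (t (tl b))" for b
  have "is_section n (Suc k) X m t'"
    unfolding is_section_def
  proof (intro ballI conjI allI impI)
    fix b assume b: "b \<in> placements n (Suc k)"
    then obtain w d where d: "b = w # d" "d \<in> placements n k" "w \<in> {1..n}" "w \<notin> set d"
      by (rule placements_SucE)
    show t'b: "t' b \<in> X b"
      using move_closed [OF sc [OF d(2)], of 0 w "t d"] tX [OF d(2)] d b by (simp add: t'_def)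
    fix i x assume i: "i < Suc k" and bx: "b[i := x] \<in> placements n (Suc k)"
    show "t' (b[i := x]) = m b i x (t' b)"
    proof (cases i)
      case 0
      then show ?thesis
        using move_move [OF sc [OF d(2)], of 0 w x "t d"] tX [OF d(2)] d b bx by (simp add: t'_def)
    next
      case (Suc j)
      then have j: "j < k" and dx: "d[j := x] \<in> placements n k" and w: "w \<notin> set (d[j := x])"
        using i bx d by (auto simp: placements_Cons)
      then have "w \<noteq> x" using d(2) set_update_memI [of j d x] by (auto simp: placements_def)
      then show ?thesis
        using lift_fibre_move [OF ls n'(1) d(2) j dx tX [OF d(2)] d(3) _ d(4)]
          push_move_eq_fibre_move [OF ls n'(1) d(2) j dx tX [OF d(2)] d(3) _ d(4)]
          tm [OF d(2) j dx] d Suc by (simp add: t'_def)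
    qed
  qed
  moreover have "t' a = u"
    using move_move [OF Suc.prems(3), of 0 "spare n (set c)" z u] move_stay [OF Suc.prems(3), of 0 u]
      Suc.prems(3,4) sc [OF a(2)] a t(2) by (simp add: t'_def v_def)
  ultimately show ?case by blast
qed

section \<open>Evaluation in the free idempotent generated semigroup\<close>

text \<open>
  The value of a nonempty word. There is no identity element that could serve as the value of the
  empty word, which is therefore left unspecified.
\<close>

fun word_prod :: "('a, 'm) semigrp_scheme \<Rightarrow> 'a list \<Rightarrow> 'a" where
  "word_prod S [a] = a"
| "word_prod S (a # b # w) = a \<cdot>\<^bsub>S\<^esub> word_prod S (b # w)"

lemma word_prod_Cons: "w \<noteq> [] \<Longrightarrow> word_prod S (a # w) = a \<cdot>\<^bsub>S\<^esub> word_prod S w"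
  by (cases w) auto

text \<open>
  The canonical homomorphism from \<open>IG S\<close> to \<open>S\<close> that extends the identity on idempotents; by
  lemma \<open>word_prod_cong\<close> the choice of the representative does not matter.
\<close>

definition IG_eval :: "('a, 'm) semigrp_scheme \<Rightarrow> 'a list set \<Rightarrow> 'a" where
  "IG_eval S x = word_prod S (SOME w. w \<in> x)"

context semigrp
begin

abbreviation IG_words where
  "IG_words \<equiv> free_semigrp_words (idempotents S)"

abbreviation IG_cong where
  "IG_cong \<equiv> presentation_cong (idempotents S) (IG_relations S)"

lemma equiv_IG_cong: "equiv IG_words IG_cong"
  by (rule equiv_presentation_cong [OF IG_relations_subset])

lemma IG_cong_words: "(u, v) \<in> IG_cong \<Longrightarrow> u \<in> IG_words \<and> v \<in> IG_words"
  using equiv_IG_cong by (auto simp: equiv_def)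

lemma carrier_IG: "carrier (IG S) = IG_words // IG_cong"
  by (simp add: IG_def presented_semigrp_def)

lemma word_prod_closed:
  assumes "w \<in> IG_words"
  shows "word_prod S w \<in> carrier S"
proof -
  have "w \<noteq> []" "set w \<subseteq> carrier S"
    using assms by (auto simp: free_semigrp_words_def idempotents_def)
  then show ?thesis by (induction w rule: list_nonempty_induct) (auto simp: word_prod_Cons)
qed

lemma word_prod_append:
  assumes "u \<in> IG_words" and v: "v \<in> IG_words"
  shows "word_prod S (u @ v) = word_prod S u \<cdot> word_prod S v"
proof -
  have "u \<noteq> []" "u \<in> IG_words" using assms by (auto simp: free_semigrp_words_def)
  then show ?thesis
  proof (induction u rule: list_nonempty_induct)
    case (single a)
    then show ?case using v by (simp add: word_prod_Cons free_semigrp_words_def)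
  next
    case (cons a u)
    then have a: "a \<in> carrier S" and u: "u \<in> IG_words"
      by (auto simp: free_semigrp_words_def idempotents_def)
    have "word_prod S ((a # u) @ v) = a \<cdot> (word_prod S u \<cdot> word_prod S v)"
      using cons u by (simp add: word_prod_Cons)
    also have "\<dots> = word_prod S (a # u) \<cdot> word_prod S v"
      using cons a u v word_prod_closed by (simp add: word_prod_Cons sprod_assoc)
    finally show ?case .
  qed
qed

lemma word_prod_cong: "(u, v) \<in> IG_cong \<Longrightarrow> word_prod S u = word_prod S v"
proof (induction rule: presentation_cong.induct)
  case (append u v u' v')
  then show ?case using IG_cong_words word_prod_append by metis
qed (auto simp: IG_relations_def)

lemma IG_eval_class: "w \<in> IG_words \<Longrightarrow> IG_eval S (IG_cong `` {w}) = word_prod S w"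
  unfolding IG_eval_def
  by (rule someI2 [of _ w]) (auto intro: presentation_cong.refl word_prod_cong [symmetric])

lemma IG_eval_gen: "e \<in> idempotents S \<Longrightarrow> IG_eval S (IG_gen S e) = e"
  by (simp add: IG_gen_def IG_eval_class free_semigrp_words_def)

lemma IG_eval_sprod:
  assumes "x \<in> carrier (IG S)" "y \<in> carrier (IG S)"
  shows "IG_eval S (x \<cdot>\<^bsub>IG S\<^esub> y) = IG_eval S x \<cdot> IG_eval S y"
proof -
  obtain u where u: "u \<in> IG_words" "x = IG_cong `` {u}"
    using assms(1) unfolding carrier_IG by (rule quotientE)
  obtain v where v: "v \<in> IG_words" "y = IG_cong `` {v}"
    using assms(2) unfolding carrier_IG by (rule quotientE)
  have "u @ v \<in> IG_words" using u v by (auto simp: free_semigrp_words_def)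
  then show ?thesis
    using u v presented_semigrp_sprod_class [OF IG_relations_subset u(1) v(1)]
    by (simp add: IG_def IG_eval_class word_prod_append)
qed

lemma IG_eval_closed: "x \<in> carrier (IG S) \<Longrightarrow> IG_eval S x \<in> carrier S"
  unfolding carrier_IG by (elim quotientE) (simp add: IG_eval_class word_prod_closed)

lemma IG_gen_closed: "e \<in> idempotents S \<Longrightarrow> IG_gen S e \<in> carrier (IG S)"
  using IG_gen_idempotent by (auto simp: idempotents_def)

lemma IG_gen_sprod:
  assumes "basic_pair S e f"
  shows "IG_gen S e \<cdot>\<^bsub>IG S\<^esub> IG_gen S f = IG_gen S (e \<cdot> f)"
proof -
  have "[e] \<in> IG_words" "[f] \<in> IG_words"
    using assms by (auto simp: basic_pair_def free_semigrp_words_def)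
  then have "IG_gen S e \<cdot>\<^bsub>IG S\<^esub> IG_gen S f = IG_cong `` {[e, f]}"
    using presented_semigrp_sprod_class [OF IG_relations_subset] by (simp add: IG_def IG_gen_def)
  also have "\<dots> = IG_gen S (e \<cdot> f)"
    unfolding IG_gen_def
    using assms by (intro equiv_class_eq [OF equiv_IG_cong] presentation_cong.relation)
      (auto simp: IG_relations_def)
  finally show ?thesis .
qed

lemma IG_induct [consumes 1, case_names gen snoc]:
  assumes "x \<in> carrier (IG S)"
    and gen: "\<And>g. g \<in> idempotents S \<Longrightarrow> P (IG_gen S g)"
    and snoc: "\<And>x g. x \<in> carrier (IG S) \<Longrightarrow> g \<in> idempotents S \<Longrightarrow> P x \<Longrightarrow>
      P (x \<cdot>\<^bsub>IG S\<^esub> IG_gen S g)"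
  shows "P x"
proof -
  obtain w where w: "w \<in> IG_words" "x = IG_cong `` {w}"
    using assms(1) unfolding carrier_IG by (rule quotientE)
  have "w \<noteq> []" using w by (simp add: free_semigrp_words_def)
  then have "w \<in> IG_words \<Longrightarrow> P (IG_cong `` {w})"
  proof (induction w rule: rev_nonempty_induct)
    case (single g)
    then show ?case using gen [of g] by (simp add: IG_gen_def free_semigrp_words_def)
  next
    case (snoc g w)
    then have gw: "[g] \<in> IG_words" "w \<in> IG_words" by (auto simp: free_semigrp_words_def)
    then have "P (IG_cong `` {w} \<cdot>\<^bsub>IG S\<^esub> IG_gen S g)"
      using snoc assms(3) [of "IG_cong `` {w}" g]
      by (simp add: carrier_IG quotientI free_semigrp_words_def)
    then show ?case
      using presented_semigrp_sprod_class [OF IG_relations_subset gw(2,1)]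
      by (simp add: IG_def IG_gen_def)
  qed
  then show ?thesis using w by simp
qed

text \<open>
  The basic pairs that matter are those with \<open>gp = p\<close>. Then \<open>pg\<close> is an idempotent in the \<open>R\<close>-class
  of \<open>p\<close>, and multiplying by \<open>g\<close> stays among the idempotents of \<open>S\<close>.
\<close>

lemma
  assumes p: "p \<in> idempotents S" and g: "g \<in> idempotents S" and gp: "g \<cdot> p = p"
  shows right_mult_idempotent: "p \<cdot> g \<in> idempotents S"
    and IG_gen_absorb: "u \<in> carrier (IG S) \<Longrightarrow>
      u \<cdot>\<^bsub>IG S\<^esub> IG_gen S p \<cdot>\<^bsub>IG S\<^esub> IG_gen S g = u \<cdot>\<^bsub>IG S\<^esub> IG_gen S (p \<cdot> g)"
proof -
  interpret IG: semigrp "IG S" by (rule semigrp_IG)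
  have bp: "basic_pair S p g" using assms by (simp add: basic_pair_def)
  then show "p \<cdot> g \<in> idempotents S" by (rule basic_pair_sprod_idempotent)
  show "u \<cdot>\<^bsub>IG S\<^esub> IG_gen S p \<cdot>\<^bsub>IG S\<^esub> IG_gen S g = u \<cdot>\<^bsub>IG S\<^esub> IG_gen S (p \<cdot> g)"
    if "u \<in> carrier (IG S)"
    using that IG_gen_closed p g IG.sprod_assoc IG_gen_sprod [OF bp] by simp
qed

text \<open>
  If one idempotent \<open>p\<close> with \<open>u \<cdot> p = u\<close> absorbs both \<open>g\<close> and \<open>h\<close>, then \<open>u \<cdot> g \<cdot> h\<close> depends only on the
  product \<open>pgh\<close> in \<open>S\<close>. This turns equations between products in \<open>S\<close> into equations in \<open>IG S\<close>
  although neither \<open>{g, h}\<close> nor \<open>{p, gh}\<close> needs to be a basic pair.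
\<close>

lemma IG_gen_absorb2:
  assumes p: "p \<in> idempotents S" and g: "g \<in> idempotents S" "g \<cdot> p = p"
    and h: "h \<in> idempotents S" "h \<cdot> p = p"
    and u: "u \<in> carrier (IG S)" "u \<cdot>\<^bsub>IG S\<^esub> IG_gen S p = u"
  shows "u \<cdot>\<^bsub>IG S\<^esub> IG_gen S g \<cdot>\<^bsub>IG S\<^esub> IG_gen S h = u \<cdot>\<^bsub>IG S\<^esub> IG_gen S (p \<cdot> g \<cdot> h)"
proof -
  have c: "p \<in> carrier S" "g \<in> carrier S" "h \<in> carrier S" using p g h by (auto simp: idempotents_def)
  have "h \<cdot> (p \<cdot> g) = p \<cdot> g" using sprod_assoc [of h p g] c h by simp
  then show ?thesis
    using IG_gen_absorb [OF p g u(1)] u(2)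
      IG_gen_absorb [OF right_mult_idempotent [OF p g] h(1) _ u(1)] by simp
qed

end

section \<open>Idempotent partial transformations\<close>

lemma PT_sprod: "f \<cdot>\<^bsub>PT n\<^esub> g = g \<circ>\<^sub>m f"
  by (simp add: PT_def)

lemma PT_carrier: "f \<in> carrier (PT n) \<longleftrightarrow> (\<forall>x y. f x = Some y \<longrightarrow> x \<in> {1..n} \<and> y \<in> {1..n})"
  by (auto simp: PT_def dom_def ran_def)

lemma PT_idempotent_iff:
  "g \<in> idempotents (PT n) \<longleftrightarrow> g \<in> carrier (PT n) \<and> (\<forall>x y. g x = Some y \<longrightarrow> g y = Some y)"
proof -
  have "g \<circ>\<^sub>m g = g \<longleftrightarrow> (\<forall>x y. g x = Some y \<longrightarrow> g y = Some y)"
    by (auto simp: fun_eq_iff map_comp_def split: option.splits)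
  then show ?thesis by (auto simp: idempotents_def PT_sprod)
qed

text \<open>
  For distinct points \<open>x\<close> and \<open>y\<close> of \<open>{1..n}\<close> this is the idempotent of rank \<open>n - 1\<close> that moves a
  token from \<open>x\<close> to \<open>y\<close>.
\<close>

definition collapse :: "nat \<Rightarrow> nat \<Rightarrow> nat \<Rightarrow> nat \<rightharpoonup> nat" where
  "collapse n x y z = (if z \<in> {1..n} then Some (if z = x then y else z) else None)"

lemma collapse_idempotent: "y \<in> {1..n} \<Longrightarrow> collapse n x y \<in> idempotents (PT n)"
  by (auto simp: PT_idempotent_iff PT_carrier collapse_def split: if_splits)

text \<open>
  A map whose kernel identifies \<open>x\<close> and \<open>y\<close> does not notice that \<open>x\<close> has been collapsed onto \<open>y\<close>.
\<close>

lemma collapse_sprod_absorb: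
  assumes "p \<in> carrier (PT n)" "p x = p y"
  shows "collapse n x y \<cdot>\<^bsub>PT n\<^esub> p = p"
proof
  fix z
  have "p z = None" if "z \<notin> {1..n}" using that assms(1) by (cases "p z") (auto simp: PT_carrier)
  then show "(collapse n x y \<cdot>\<^bsub>PT n\<^esub> p) z = p z"
    using assms(2) by (auto simp: PT_sprod map_comp_def collapse_def)
qed

lemma idempotents_same_image_sprod:
  assumes "p \<in> idempotents (PT n)" "q \<in> idempotents (PT n)" "ran p = ran q"
  shows "p \<cdot>\<^bsub>PT n\<^esub> q = p"
proof
  fix z
  show "(p \<cdot>\<^bsub>PT n\<^esub> q) z = p z"
  proof (cases "p z")
    case (Some y)
    then have "y \<in> ran q" using assms(3) by (auto simp: ran_def)
    then show ?thesis using assms(2) Some by (auto simp: PT_sprod ran_def PT_idempotent_iff)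
  qed (simp add: PT_sprod)
qed

lemma placement_nth:
  assumes "a \<in> placements n k" "i < k"
  shows "a ! i \<in> set a" "a ! i \<in> {1..n}"
proof -
  show "a ! i \<in> set a" using assms by (auto simp: placements_def)
  then show "a ! i \<in> {1..n}" using assms by (auto simp: placements_def simp del: nth_mem)
qed

lemma placement_update_iff:
  assumes a: "a \<in> placements n k" and i: "i < k"
  shows "a[i := x] \<in> placements n k \<longleftrightarrow> x \<in> {1..n} \<and> x \<notin> set a - {a ! i}"
proof -
  have len: "length a = k" "distinct a" and sub: "set a \<subseteq> {1..n}" using a by (auto simp: placements_def)
  have eq: "set (a[i := x]) = insert x (set a - {a ! i})"
    using set_update_distinct [OF len(2), of i x] len i by simp
  have "distinct (a[i := x]) \<longleftrightarrow> x \<notin> set a - {a ! i}"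
  proof
    assume d: "distinct (a[i := x])"
    show "x \<notin> set a - {a ! i}"
    proof
      assume x: "x \<in> set a - {a ! i}"
      have ai: "a ! i \<in> set a" using len i by simp
      have "card (set (a[i := x])) < card (set a)"
        unfolding eq using x ai by (intro psubset_card_mono) auto
      then show False using d len by (simp add: distinct_card)
    qed
  qed (rule distinct_list_update [OF len(2)])
  then show ?thesis using len sub eq by (auto simp: placements_def)
qed

text \<open>
  The retraction onto the occupied points that folds the destination \<open>x\<close> of token \<open>i\<close> onto its
  present position, and the destination \<open>y\<close> of token \<open>j\<close> likewise, so that it absorbs both of the
  corresponding collapsing maps. Occupied points come first in the case distinction since \<open>x\<close> and
  \<open>y\<close> may be the present positions themselves.
\<close>

definition retraction :: "nat list \<Rightarrow> nat \<Rightarrow> nat \<Rightarrow> nat \<Rightarrow> nat \<Rightarrow> nat \<rightharpoonup> nat" where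
  "retraction a i x j y z = (if z \<in> set a then Some z else if z = x then Some (a ! i)
    else if z = y then Some (a ! j) else None)"

lemma
  assumes a: "a \<in> placements n k" and ij: "i < k" "j < k" and xy: "x \<in> {1..n}" "y \<in> {1..n}"
  shows retraction_idempotent: "retraction a i x j y \<in> idempotents (PT n)"
    and ran_retraction: "ran (retraction a i x j y) = set a"
proof -
  have in_set: "a ! i \<in> set a" "a ! j \<in> set a" "set a \<subseteq> {1..n}" using a ij by (auto simp: placements_def)
  then show "retraction a i x j y \<in> idempotents (PT n)"
    using xy by (auto simp: PT_idempotent_iff PT_carrier retraction_def split: if_splits)
  show "ran (retraction a i x j y) = set a"
    using in_set by (auto simp: ran_def retraction_def)
qed

lemma retraction_fst:
  assumes "a \<in> placements n k" "i < k" "a[i := x] \<in> placements n k"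
  shows "retraction a i x j y x = Some (a ! i)" "retraction a i x j y (a ! i) = Some (a ! i)"
  using assms placement_update_iff [OF assms(1,2)]
  by (auto simp: retraction_def placements_def)

lemma retraction_sprod_cong:
  assumes "\<And>z. z \<in> set a \<Longrightarrow> f z = g z" "i < length a" "j < length a"
  shows "retraction a i x j y \<cdot>\<^bsub>PT n\<^esub> f = retraction a i x j y \<cdot>\<^bsub>PT n\<^esub> g"
  using assms by (auto simp: fun_eq_iff PT_sprod map_comp_def retraction_def)

section \<open>Right multiplication as a movement of tokens\<close>

text \<open>
  The elements whose \<open>L\<close>-class is at or below that of the idempotents with image \<open>set a\<close>. These
  idempotents are \<open>L\<close>-related to one another already in \<open>IG (PT n)\<close>, so that fixing \<open>u\<close> on the right
  is the same condition for each of them (lemma \<open>supportedI\<close>).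
\<close>

definition supported :: "nat \<Rightarrow> nat list \<Rightarrow> (nat \<rightharpoonup> nat) list set set" where
  "supported n a = {u \<in> carrier (IG (PT n)). \<forall>p \<in> idempotents (PT n). ran p = set a \<longrightarrow>
    u \<cdot>\<^bsub>IG (PT n)\<^esub> IG_gen (PT n) p = u}"

definition slide :: "nat \<Rightarrow> nat list \<Rightarrow> nat \<Rightarrow> nat \<Rightarrow> (nat \<rightharpoonup> nat) list set \<Rightarrow> (nat \<rightharpoonup> nat) list set" where
  "slide n a i x u = u \<cdot>\<^bsub>IG (PT n)\<^esub> IG_gen (PT n) (collapse n (a ! i) x)"

lemma supportedI:
  assumes u: "u \<in> carrier (IG (PT n))" and p: "p \<in> idempotents (PT n)" "ran p = set a"
  shows "u \<cdot>\<^bsub>IG (PT n)\<^esub> IG_gen (PT n) p \<in> supported n a"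
proof -
  interpret S: semigrp "PT n" by (rule semigrp_PT)
  interpret IG: semigrp "IG (PT n)" by (rule S.semigrp_IG)
  have "IG_gen (PT n) p \<cdot>\<^bsub>IG (PT n)\<^esub> IG_gen (PT n) q = IG_gen (PT n) p"
    if "q \<in> idempotents (PT n)" "ran q = set a" for q
  proof -
    have "p \<cdot>\<^bsub>PT n\<^esub> q = p" using idempotents_same_image_sprod p that by auto
    then show ?thesis using S.IG_gen_sprod [of p q] p that by (simp add: basic_pair_def)
  qed
  then show ?thesis
    using u p by (auto simp: supported_def S.IG_gen_closed IG.sprod_assoc)
qed

lemma
  assumes a: "a \<in> placements n k" and i: "i < k" and ax: "a[i := x] \<in> placements n k"
  shows collapse_placement_idempotent: "collapse n (a ! i) x \<in> idempotents (PT n)"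
    and collapse_retraction_fst: "y \<in> {1..n} \<Longrightarrow> j < k \<Longrightarrow>
      collapse n (a ! i) x \<cdot>\<^bsub>PT n\<^esub> retraction a i x j y = retraction a i x j y"
proof -
  have x: "x \<in> {1..n}" using placement_update_iff [OF a i] ax by simp
  then show "collapse n (a ! i) x \<in> idempotents (PT n)" by (rule collapse_idempotent)
  show "collapse n (a ! i) x \<cdot>\<^bsub>PT n\<^esub> retraction a i x j y = retraction a i x j y"
    if "y \<in> {1..n}" "j < k"
    by (rule collapse_sprod_absorb)
      (use retraction_idempotent [OF a i that(2) x that(1)] retraction_fst [OF a i ax]
        in \<open>auto simp: idempotents_def\<close>)
qed

text \<open>
  In each of the laws, a retraction that absorbs all the collapsing maps involved reduces the claim to
  an equation between partial maps which only has to be checked on the occupied points.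
\<close>

lemma local_system_supported: "local_system n k (supported n) (slide n)"
proof -
  interpret S: semigrp "PT n" by (rule semigrp_PT)
  show ?thesis
  proof
    fix a i x u
    assume a: "a \<in> placements n k" "i < k" and ax: "a[i := x] \<in> placements n k"
      and u: "u \<in> supported n a"
    let ?p = "retraction a i x i x" and ?g = "collapse n (a ! i) x"
    have x: "x \<in> {1..n}" using placement_update_iff [OF a] ax by simp
    note p = retraction_idempotent [OF a a(2) x x] ran_retraction [OF a a(2) x x]
    note g = collapse_placement_idempotent [OF a ax] collapse_retraction_fst [OF a ax x a(2)]
    have uc: "u \<in> carrier (IG (PT n))" and up: "u \<cdot>\<^bsub>IG (PT n)\<^esub> IG_gen (PT n) ?p = u"
      using u p by (auto simp: supported_def)
    have "slide n a i x u = u \<cdot>\<^bsub>IG (PT n)\<^esub> IG_gen (PT n) (?p \<cdot>\<^bsub>PT n\<^esub> ?g)"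
      using S.IG_gen_absorb [OF p(1) g uc] up by (simp add: slide_def)
    moreover have "ran (?p \<cdot>\<^bsub>PT n\<^esub> ?g) = set (a[i := x])"
    proof -
      have "distinct a" "length a = k" "set a \<subseteq> {1..n}" using a by (auto simp: placements_def)
      then have "set (a[i := x]) = insert x (set a - {a ! i})" "a ! i \<in> set a"
        using set_update_distinct [of a i x] a by auto
      moreover have "ran (?p \<cdot>\<^bsub>PT n\<^esub> ?g) = {y. \<exists>w \<in> ran ?p. ?g w = Some y}"
        by (force simp: PT_sprod ran_def map_comp_Some_iff)
      moreover have "?g w = Some (if w = a ! i then x else w)" if "w \<in> set a" for w
        using that \<open>set a \<subseteq> {1..n}\<close> by (auto simp: collapse_def)
      then have "{y. \<exists>w \<in> set a. ?g w = Some y} = {y. \<exists>w \<in> set a. y = (if w = a ! i then x else w)}"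
        by auto
      ultimately show ?thesis using p(2) by auto
    qed
    ultimately show "slide n a i x u \<in> supported n (a[i := x])"
      using supportedI [OF uc S.right_mult_idempotent [OF p(1) g]] by simp
  next
    fix a i u
    assume a: "a \<in> placements n k" "i < k" and u: "u \<in> supported n a"
    have x: "a ! i \<in> {1..n}" using placement_nth [OF a] by simp
    let ?p = "retraction a i (a ! i) i (a ! i)" and ?g = "collapse n (a ! i) (a ! i)"
    have ax: "a[i := a ! i] \<in> placements n k" using a by simp
    note p = retraction_idempotent [OF a a(2) x x] ran_retraction [OF a a(2) x x]
    note g = collapse_placement_idempotent [OF a ax] collapse_retraction_fst [OF a ax x a(2)]
    have uc: "u \<in> carrier (IG (PT n))" and up: "u \<cdot>\<^bsub>IG (PT n)\<^esub> IG_gen (PT n) ?p = u"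
      using u p by (auto simp: supported_def)
    have "?p \<cdot>\<^bsub>PT n\<^esub> ?g = ?p"
      using p(1) by (auto simp: fun_eq_iff PT_sprod map_comp_def collapse_def PT_idempotent_iff
          PT_carrier split: option.splits)
    then show "slide n a i (a ! i) u = u"
      using S.IG_gen_absorb [OF p(1) g uc] up by (simp add: slide_def)
  next
    fix a i x y u
    assume a: "a \<in> placements n k" "i < k" and ax: "a[i := x] \<in> placements n k"
      and ay: "a[i := y] \<in> placements n k" and u: "u \<in> supported n a"
    let ?p = "retraction a i x i y"
    have x: "x \<in> {1..n}" "x \<notin> set a - {a ! i}" using placement_update_iff [OF a] ax by auto
    have y: "y \<in> {1..n}" "y \<notin> set a - {a ! i}" using placement_update_iff [OF a] ay by auto
    note p = retraction_idempotent [OF a a(2) x(1) y(1)] ran_retraction [OF a a(2) x(1) y(1)]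
    have len: "length a = k" "set a \<subseteq> {1..n}" using a by (auto simp: placements_def)
    have pc: "?p \<in> carrier (PT n)" using p(1) by (simp add: idempotents_def)
    have px: "?p x = Some (a ! i)" "?p y = Some (a ! i)" "?p (a ! i) = Some (a ! i)"
      using x y a len by (auto simp: retraction_def)
    have uc: "u \<in> carrier (IG (PT n))" and up: "u \<cdot>\<^bsub>IG (PT n)\<^esub> IG_gen (PT n) ?p = u"
      using u p by (auto simp: supported_def)
    have "slide n (a[i := x]) i y (slide n a i x u) = u \<cdot>\<^bsub>IG (PT n)\<^esub>
        IG_gen (PT n) (?p \<cdot>\<^bsub>PT n\<^esub> collapse n (a ! i) x \<cdot>\<^bsub>PT n\<^esub> collapse n x y)"
      using S.IG_gen_absorb2 [OF p(1) collapse_idempotent [OF x(1)] _ collapse_idempotent [OF y(1)] _ uc up]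
        collapse_sprod_absorb [OF pc] px a len by (simp add: slide_def)
    also have "?p \<cdot>\<^bsub>PT n\<^esub> collapse n (a ! i) x \<cdot>\<^bsub>PT n\<^esub> collapse n x y =
        ?p \<cdot>\<^bsub>PT n\<^esub> (collapse n (a ! i) x \<cdot>\<^bsub>PT n\<^esub> collapse n x y)"
      using collapse_idempotent x y pc by (simp add: S.sprod_assoc idempotents_def)
    also have "\<dots> = ?p \<cdot>\<^bsub>PT n\<^esub> collapse n (a ! i) y"
      by (rule retraction_sprod_cong) (use a x y len in \<open>auto simp: PT_sprod collapse_def\<close>)
    also have "u \<cdot>\<^bsub>IG (PT n)\<^esub> IG_gen (PT n) \<dots> = slide n a i y u"
      using S.IG_gen_absorb [OF p(1) collapse_idempotent [OF y(1)] _ uc] up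
        collapse_sprod_absorb [OF pc] px by (simp add: slide_def)
    finally show "slide n (a[i := x]) i y (slide n a i x u) = slide n a i y u" .
  next
    fix a i j x y u
    assume a: "a \<in> placements n k" and ij: "i < k" "j < k" "i \<noteq> j"
      and ax: "a[i := x] \<in> placements n k" and ay: "a[j := y] \<in> placements n k"
      and axy: "a[i := x, j := y] \<in> placements n k" and u: "u \<in> supported n a"
    let ?p = "retraction a i x j y"
    have len: "length a = k" "set a \<subseteq> {1..n}" "distinct a" using a by (auto simp: placements_def)
    have x: "x \<in> {1..n}" "x \<notin> set a - {a ! i}" using placement_update_iff [OF a ij(1)] ax by auto
    have y: "y \<in> {1..n}" "y \<notin> set a - {a ! j}" using placement_update_iff [OF a ij(2)] ay by auto
    have aij: "a ! i \<noteq> a ! j" using len ij by (simp add: nth_eq_iff_index_eq)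
    have "a[i := x] ! i \<in> set (a[i := x]) - {a[i := x] ! j}"
    proof -
      have "distinct (a[i := x])" using ax by (simp add: placements_def)
      then show ?thesis using ij len nth_eq_iff_index_eq [of "a[i := x]" i j]
        by (simp del: nth_list_update_neq nth_list_update_eq)
    qed
    then have xy: "x \<noteq> y" using placement_update_iff [OF ax ij(2), of y] axy ij len by auto
    note p = retraction_idempotent [OF a ij(1,2) x(1) y(1)] ran_retraction [OF a ij(1,2) x(1) y(1)]
    have pc: "?p \<in> carrier (PT n)" using p(1) by (simp add: idempotents_def)
    have px: "?p x = Some (a ! i)" "?p (a ! i) = Some (a ! i)"
        "?p y = Some (a ! j)" "?p (a ! j) = Some (a ! j)"
      using x y xy ij len by (auto simp: retraction_def)
    have uc: "u \<in> carrier (IG (PT n))" and up: "u \<cdot>\<^bsub>IG (PT n)\<^esub> IG_gen (PT n) ?p = u"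
      using u p by (auto simp: supported_def)
    let ?g = "collapse n (a ! i) x" and ?h = "collapse n (a ! j) y"
    note absorb2 = S.IG_gen_absorb2 [OF p(1) _ _ _ _ uc up]
    have g: "?g \<in> idempotents (PT n)" "?g \<cdot>\<^bsub>PT n\<^esub> ?p = ?p"
      using collapse_idempotent [OF x(1)] collapse_sprod_absorb [OF pc] px by auto
    have h: "?h \<in> idempotents (PT n)" "?h \<cdot>\<^bsub>PT n\<^esub> ?p = ?p"
      using collapse_idempotent [OF y(1)] collapse_sprod_absorb [OF pc] px by auto
    have comm: "?p \<cdot>\<^bsub>PT n\<^esub> ?g \<cdot>\<^bsub>PT n\<^esub> ?h = ?p \<cdot>\<^bsub>PT n\<^esub> ?h \<cdot>\<^bsub>PT n\<^esub> ?g"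
    proof -
      have "(?g \<cdot>\<^bsub>PT n\<^esub> ?h) z = (?h \<cdot>\<^bsub>PT n\<^esub> ?g) z" if "z \<in> set a" for z
      proof -
        have "x \<noteq> a ! j" "y \<noteq> a ! i" using x y aij placement_nth [OF a] ij by auto
        moreover have "z \<in> {1..n}" using that len by blast
        ultimately show ?thesis using x y aij xy by (simp add: PT_sprod collapse_def)
      qed
      then have "?p \<cdot>\<^bsub>PT n\<^esub> (?g \<cdot>\<^bsub>PT n\<^esub> ?h) = ?p \<cdot>\<^bsub>PT n\<^esub> (?h \<cdot>\<^bsub>PT n\<^esub> ?g)"
        by (rule retraction_sprod_cong) (use ij len in simp_all)
      moreover have "?g \<in> carrier (PT n)" "?h \<in> carrier (PT n)"
        using g(1) h(1) by (simp_all add: idempotents_def)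
      ultimately show ?thesis using pc S.sprod_assoc by metis
    qed
    show "slide n (a[i := x]) j y (slide n a i x u) = slide n (a[j := y]) i x (slide n a j y u)"
      using absorb2 [OF g h] absorb2 [OF h g] comm ij by (simp add: slide_def)
  qed
qed

lemma map_placement:
  assumes a: "a \<in> placements n k" and f: "f \<in> carrier (PT n)" "set a \<subseteq> dom f" "inj_on f (set a)"
  shows "map (the \<circ> f) a \<in> placements n k"
proof -
  have "inj_on (the \<circ> f) (set a)"
    using f(2,3) by (auto simp: inj_on_def) (metis domIff option.expand subsetD)
  moreover have "(the \<circ> f) x \<in> {1..n}" if "x \<in> set a" for x
    using that f(1,2) by (force simp: PT_carrier)
  ultimately show ?thesis using a by (auto simp: placements_def distinct_map)
qed

text \<open>
  An arbitrary idempotent \<open>g\<close> that is defined and injective on the occupied points acts like the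
  steps that move the tokens to their images under \<open>g\<close> one after the other. No token ever gets in the
  way of another: if \<open>a ! i\<close> is sent to a point occupied by token \<open>j\<close>, then this point is fixed by
  \<open>g\<close>, whence \<open>i = j\<close> by injectivity. All these steps and \<open>g\<close> itself are absorbed by the retraction
  \<open>p\<close> that sends \<open>z\<close> to the occupied point with the same image under \<open>g\<close>, so both sides are given by
  the product of \<open>p\<close> with a map, and these maps agree on the occupied points.
\<close>

lemma section_mult_gen:
  assumes t: "is_section n k (supported n) (slide n) t" and a: "a \<in> placements n k"
    and g: "g \<in> idempotents (PT n)" and dom: "set a \<subseteq> dom g" and inj: "inj_on g (set a)"
  shows "t a \<cdot>\<^bsub>IG (PT n)\<^esub> IG_gen (PT n) g = t (map (the \<circ> g) a)"
proof -
  interpret S: semigrp "PT n" by (rule semigrp_PT)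
  have len: "length a = k" "distinct a" "set a \<subseteq> {1..n}" using a by (auto simp: placements_def)
  have gc: "g \<in> carrier (PT n)" and gg: "g z = Some y \<Longrightarrow> g y = Some y" for y z
    using g by (auto simp: PT_idempotent_iff)
  define p where "p z = (if g z \<in> g ` set a then Some (inv_into (set a) g (g z)) else None)" for z
  have p_iff: "p z = Some y \<longleftrightarrow> y \<in> set a \<and> g z = g y" for z y
    using inj by (auto simp: p_def inv_into_into f_inv_into_f inj_on_eq_iff)
  have p_eq: "p y = p z" if "g y = g z" for y z using that by (simp add: p_def)
  have p: "p \<in> idempotents (PT n)"
  proof -
    have "z \<in> {1..n}" if "y \<in> set a" "g z = g y" for z y
      using that gc dom by (force simp: PT_carrier)
    then show ?thesis using len by (auto simp: PT_idempotent_iff PT_carrier p_iff)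
  qed
  have ran_p: "ran p = set a" by (auto simp: ran_def p_iff)
  have pc: "p \<in> carrier (PT n)" using p by (simp add: idempotents_def)
  have ta: "t a \<in> carrier (IG (PT n))" "t a \<cdot>\<^bsub>IG (PT n)\<^esub> IG_gen (PT n) p = t a"
    using t a p ran_p by (auto simp: is_section_def supported_def)
  define b where "b = map (the \<circ> g) a"
  have gb: "g (a ! j) = Some (b ! j)" if "j < k" for j
    using that subsetD [OF dom placement_nth(1) [OF a that]] len by (auto simp: b_def)
  have bn: "b ! j \<in> {1..n}" if "j < k" for j
    using gb [OF that] gc by (auto simp: PT_carrier)
  have bb: "g (b ! j) = Some (b ! j)" if "j < k" for j
    using gg gb [OF that] by blast
  have ab: "i = j" if "i < k" "j < k" "g (a ! i) = g (a ! j)" for i j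
    using that inj len by (auto simp: inj_on_eq_iff nth_eq_iff_index_eq)
  \<comment> \<open>the placement after the first \<open>i\<close> tokens have been moved\<close>
  define c where "c i = map (\<lambda>j. if j < i then b ! j else a ! j) [0..<k]" for i
  have c: "c i \<in> placements n k" for i
  proof -
    have gc: "g (c i ! j) = g (a ! j)" if "j < k" for j using that gb bb by (simp add: c_def)
    have "length (c i) = k" by (simp add: c_def)
    moreover have "c i ! j \<noteq> c i ! l" if "j < k" "l < k" "j \<noteq> l" for j l
      using ab [OF that(1,2)] that gc by metis
    ultimately have "distinct (c i)" unfolding distinct_conv_nth by simp
    then show ?thesis using bn len by (auto simp: placements_def c_def)
  qed
  have step: "\<exists>q \<in> idempotents (PT n). p \<cdot>\<^bsub>PT n\<^esub> q = q \<and>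
      t (c i) = t a \<cdot>\<^bsub>IG (PT n)\<^esub> IG_gen (PT n) q \<and> (\<forall>j<k. q (a ! j) = Some (c i ! j))"
    if "i \<le> k" for i
    using that
  proof (induction i)
    case 0
    have "c 0 = a" using len by (simp add: c_def map_nth list_eq_iff_nth_eq)
    moreover have "p \<cdot>\<^bsub>PT n\<^esub> p = p" using p by (simp add: idempotents_def)
    ultimately show ?case
      using p ta len by (intro bexI [of _ p]) (auto simp: p_iff)
  next
    case (Suc i)
    then have i: "i < k" by simp
    obtain q where q: "q \<in> idempotents (PT n)" and pq: "p \<cdot>\<^bsub>PT n\<^esub> q = q"
      and tc: "t (c i) = t a \<cdot>\<^bsub>IG (PT n)\<^esub> IG_gen (PT n) q"
      and qc: "\<And>j. j < k \<Longrightarrow> q (a ! j) = Some (c i ! j)"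
      using Suc by auto
    have qcar: "q \<in> carrier (PT n)" using q by (simp add: idempotents_def)
    let ?h = "collapse n (a ! i) (b ! i)"
    have h: "?h \<in> idempotents (PT n)" using collapse_idempotent bn i by simp
    have hc: "?h \<in> carrier (PT n)" using h by (simp add: idempotents_def)
    have "?h \<cdot>\<^bsub>PT n\<^esub> p = p"
      by (rule collapse_sprod_absorb [OF pc]) (use gb bb i p_eq in auto)
    then have hq: "?h \<cdot>\<^bsub>PT n\<^esub> q = q" using pq S.sprod_assoc [OF hc pc qcar] by simp
    have ci: "c i ! i = a ! i" "(c i)[i := b ! i] = c (Suc i)"
      using i by (auto simp: c_def list_eq_iff_nth_eq nth_list_update)
    have "t (c (Suc i)) = slide n (c i) i (b ! i) (t (c i))"
      using section_move [OF t c i, of i "b ! i"] c [of "Suc i"] ci by simp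
    also have "\<dots> = t a \<cdot>\<^bsub>IG (PT n)\<^esub> IG_gen (PT n) (q \<cdot>\<^bsub>PT n\<^esub> ?h)"
      using S.IG_gen_absorb [OF q h hq ta(1)] tc ci by (simp add: slide_def)
    finally have "t (c (Suc i)) = \<dots>" .
    moreover have "q \<cdot>\<^bsub>PT n\<^esub> ?h \<in> idempotents (PT n)" by (rule S.right_mult_idempotent [OF q h hq])
    moreover have "p \<cdot>\<^bsub>PT n\<^esub> (q \<cdot>\<^bsub>PT n\<^esub> ?h) = q \<cdot>\<^bsub>PT n\<^esub> ?h"
      using S.sprod_assoc [OF pc qcar hc] pq by simp
    moreover have "(q \<cdot>\<^bsub>PT n\<^esub> ?h) (a ! j) = Some (c (Suc i) ! j)" if j: "j < k" for j
    proof -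
      have "c i ! j \<in> {1..n}" using qc [OF j] qcar by (auto simp: PT_carrier)
      moreover have "c i ! j = a ! i \<longleftrightarrow> j = i"
        using c [of i] ci(1) i j nth_eq_iff_index_eq [of "c i" j i] by (auto simp: placements_def)
      moreover have "c (Suc i) ! j = (if j = i then b ! i else c i ! j)"
        using i j by (auto simp: c_def)
      ultimately show ?thesis using qc [OF j] by (simp add: PT_sprod collapse_def)
    qed
    ultimately show ?case by blast
  qed
  have ck: "c k = b" using len by (simp add: c_def b_def list_eq_iff_nth_eq)
  obtain q where q: "p \<cdot>\<^bsub>PT n\<^esub> q = q" "t b = t a \<cdot>\<^bsub>IG (PT n)\<^esub> IG_gen (PT n) q"
      and qb: "\<And>j. j < k \<Longrightarrow> q (a ! j) = Some (b ! j)"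
    using step [of k] ck by auto
  have qg: "q y = g y" if "y \<in> set a" for y
    using that qb gb len by (auto simp: in_set_conv_nth)
  have "(p \<cdot>\<^bsub>PT n\<^esub> q) z = (p \<cdot>\<^bsub>PT n\<^esub> g) z" for z
    using qg by (cases "p z") (auto simp: PT_sprod p_iff)
  then have pg: "p \<cdot>\<^bsub>PT n\<^esub> g = q" using q(1) by (metis ext)
  have "(g \<cdot>\<^bsub>PT n\<^esub> p) z = p z" for z
  proof (cases "g z")
    case None
    then have "p z = None" using dom by (force simp: p_def)
    then show ?thesis using None by (simp add: PT_sprod)
  next
    case (Some y)
    then show ?thesis using gg p_eq [of y z] by (simp add: PT_sprod)
  qed
  then have "g \<cdot>\<^bsub>PT n\<^esub> p = p" by blast
  then show ?thesis using S.IG_gen_absorb [OF p g _ ta(1)] ta(2) pg q(2) by (simp add: b_def)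
qed

lemma section_mult:
  assumes t: "is_section n k (supported n) (slide n) t" and a: "a \<in> placements n k"
    and w: "w \<in> carrier (IG (PT n))"
    and "set a \<subseteq> dom (IG_eval (PT n) w)" "inj_on (IG_eval (PT n) w) (set a)"
  shows "t a \<cdot>\<^bsub>IG (PT n)\<^esub> w = t (map (the \<circ> IG_eval (PT n) w) a)"
proof -
  interpret S: semigrp "PT n" by (rule semigrp_PT)
  interpret IG: semigrp "IG (PT n)" by (rule S.semigrp_IG)
  show ?thesis
    using w assms(4,5)
  proof (induction w rule: S.IG_induct)
    case (gen g)
    then show ?case using section_mult_gen [OF t a gen(1)] by (simp only: S.IG_eval_gen)
  next
    case (snoc w g)
    let ?f = "IG_eval (PT n) w"
    let ?b = "map (the \<circ> ?f) a"
    have ev: "IG_eval (PT n) (w \<cdot>\<^bsub>IG (PT n)\<^esub> IG_gen (PT n) g) = g \<circ>\<^sub>m ?f"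
      using snoc by (simp add: S.IG_eval_sprod S.IG_eval_gen S.IG_gen_closed PT_sprod)
    have dom: "set a \<subseteq> dom ?f" using snoc.prems(1) unfolding ev by (force simp: map_comp_Some_iff)
    have inj: "inj_on ?f (set a)"
      using snoc.prems(2) unfolding ev by (auto simp: inj_on_def map_comp_def)
    have b: "?b \<in> placements n k"
      using map_placement [OF a _ dom inj] S.IG_eval_closed snoc by simp
    have gf: "(g \<circ>\<^sub>m ?f) x = g (the (?f x))" if "x \<in> set a" for x
      using that dom by (auto simp: map_comp_def)
    have dom': "set ?b \<subseteq> dom g" using snoc.prems(1) gf unfolding ev by (auto simp: dom_def)
    have inj': "inj_on g (set ?b)"
      using snoc.prems(2) gf unfolding ev by (auto simp: inj_on_def)
    have ta: "t a \<in> carrier (IG (PT n))" using t a by (auto simp: is_section_def supported_def)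
    have "t a \<cdot>\<^bsub>IG (PT n)\<^esub> (w \<cdot>\<^bsub>IG (PT n)\<^esub> IG_gen (PT n) g) =
        t ?b \<cdot>\<^bsub>IG (PT n)\<^esub> IG_gen (PT n) g"
      using IG.sprod_assoc [OF ta snoc.hyps(1) S.IG_gen_closed [OF snoc.hyps(2)]]
      by (simp only: snoc.IH [OF dom inj])
    also have "\<dots> = t (map (the \<circ> g) ?b)" using section_mult_gen [OF t b _ dom' inj'] snoc by simp
    also have "map (the \<circ> g) ?b = map (the \<circ> (g \<circ>\<^sub>m ?f)) a" using gf by simp
    finally show ?case unfolding ev .
  qed
qed

text \<open>
  A section over the placements remembers the placement: evaluated in \<open>PT n\<close>, the value of \<open>t\<close> at
  \<open>b\<close> carries the initial placement \<open>a\<close> to \<open>b\<close>. This holds at \<open>a\<close>, is preserved by steps, and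
  placements are connected.
\<close>

lemma section_eval:
  assumes t: "is_section n k (supported n) (slide n) t" and "k < n"
    and a: "a \<in> placements n k" and start: "\<And>x. x \<in> set a \<Longrightarrow> IG_eval (PT n) (t a) x = Some x"
    and b: "b \<in> placements n k" and "j < k"
  shows "IG_eval (PT n) (t b) (a ! j) = Some (b ! j)"
proof -
  interpret S: semigrp "PT n" by (rule semigrp_PT)
  have "\<forall>j<k. IG_eval (PT n) (t b) (a ! j) = Some (b ! j)"
  proof (rule placements_connected [OF \<open>k < n\<close> a _ b])
    show "\<forall>j<k. IG_eval (PT n) (t a) (a ! j) = Some (a ! j)"
      using start a by (auto simp: placements_def)
    fix c i x
    assume c: "c \<in> placements n k" "i < k" and cx: "c[i := x] \<in> placements n k"
      and ev: "\<forall>j<k. IG_eval (PT n) (t c) (a ! j) = Some (c ! j)"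
    have len: "length c = k" "distinct c" "set c \<subseteq> {1..n}" using c by (auto simp: placements_def)
    have tc: "t c \<in> carrier (IG (PT n))" and tcx: "t (c[i := x]) = slide n c i x (t c)"
      using t c cx by (auto simp: is_section_def supported_def)
    have "IG_eval (PT n) (t (c[i := x])) = collapse n (c ! i) x \<circ>\<^sub>m IG_eval (PT n) (t c)"
      using tcx tc collapse_placement_idempotent [OF c cx]
      by (simp add: slide_def S.IG_eval_sprod S.IG_eval_gen S.IG_gen_closed PT_sprod)
    moreover have "c ! j \<in> {1..n}" "c ! j = c ! i \<longleftrightarrow> j = i" if "j < k" for j
      using that placement_nth [OF c(1)] c(2) len by (simp_all add: nth_eq_iff_index_eq)
    ultimately show "\<forall>j<k. IG_eval (PT n) (t (c[i := x])) (a ! j) = Some (c[i := x] ! j)"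
      using ev len by (auto simp: collapse_def nth_list_update)
  qed
  then show ?thesis using \<open>j < k\<close> by blast
qed

section \<open>The maximal subgroup\<close>

theorem theorem3p1:
  fixes n k :: nat and e :: "nat \<rightharpoonup> nat"
  assumes "n > 0"
    and "e \<in> idempotents (PT n)"
    and "card (ran e) = k"
    and "k + 2 \<le> n"
  shows "maximal_subgroup (IG (PT n)) (IG_gen (PT n) e) \<cong> sym_group k"
proof -
  interpret S: semigrp "PT n" by (rule semigrp_PT)
  interpret IG: semigrp "IG (PT n)" by (rule S.semigrp_IG)
  note e = \<open>e \<in> idempotents (PT n)\<close>
  have fix_ran: "e y = Some y" if "y \<in> ran e" for y
    using that e by (auto simp: PT_idempotent_iff ran_def)
  have ran_n: "ran e \<subseteq> {1..n}" using e by (auto simp: PT_idempotent_iff PT_carrier ran_def)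
  then have "finite (ran e)" by (rule finite_subset) simp
  then obtain \<alpha> where \<alpha>: "bij_betw \<alpha> {1..k} (ran e)"
    using ex_bij_betw_nat_finite_1 \<open>card (ran e) = k\<close> by blast
  have \<alpha>_eq: "\<alpha> i = \<alpha> j \<longleftrightarrow> i = j" if "i \<in> {1..k}" "j \<in> {1..k}" for i j
    using \<alpha> that by (auto simp: bij_betw_def inj_on_eq_iff)
  have \<alpha>_ran: "\<alpha> i \<in> ran e" if "i \<in> {1..k}" for i using \<alpha> that by (auto simp: bij_betw_def)
  \<comment> \<open>The inverse is needed because \<open>sym_group\<close> composes from right to left.\<close>
  define c where "c p = map (\<alpha> \<circ> inv' p) [1..<Suc k]" for p
  have set_upt: "set [1..<Suc k] = {1..k}" by auto
  have perm: "inv' p permutes {1..k}" if "p \<in> carrier (sym_group k)" for p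
    using that permutes_inv by (simp add: sym_group_carrier)
  have set_c: "set (c p) = ran e" and c: "c p \<in> placements n k"
    if p: "p \<in> carrier (sym_group k)" for p
  proof -
    have "bij_betw (\<alpha> \<circ> inv' p) {1..k} (ran e)"
      using bij_betw_trans [OF permutes_imp_bij [OF perm [OF p]] \<alpha>] .
    then have *: "(\<alpha> \<circ> inv' p) ` {1..k} = ran e" "inj_on (\<alpha> \<circ> inv' p) {1..k}"
      by (simp_all add: bij_betw_def)
    show "set (c p) = ran e" using * unfolding c_def set_map set_upt by simp
    moreover have "distinct (c p)" using * unfolding c_def distinct_map set_upt by simp
    ultimately show "c p \<in> placements n k" using ran_n by (simp add: placements_def c_def)
  qed
  have one: "id \<in> carrier (sym_group k)" by (simp add: sym_group_carrier permutes_id)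
  have "IG_gen (PT n) e \<cdot>\<^bsub>IG (PT n)\<^esub> IG_gen (PT n) e \<in> supported n (c id)"
    by (rule supportedI) (use e S.IG_gen_closed set_c [OF one] in auto)
  then have "IG_gen (PT n) e \<in> supported n (c id)"
    using S.IG_gen_idempotent [OF e] by (simp add: idempotents_def)
  then obtain t where t: "is_section n k (supported n) (slide n) t" and t1: "t (c id) = IG_gen (PT n) e"
    using local_system_section [OF local_system_supported \<open>k + 2 \<le> n\<close> c [OF one]] by blast
  have tc: "t (c p) \<in> carrier (IG (PT n))" if "p \<in> carrier (sym_group k)" for p
    using t c [OF that] by (auto simp: is_section_def supported_def)
  have ev: "IG_eval (PT n) (t (c p)) (\<alpha> i) = Some (\<alpha> (inv' p i))"
    if p: "p \<in> carrier (sym_group k)" and i: "i \<in> {1..k}" for p i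
  proof -
    have "IG_eval (PT n) (t (c p)) (c id ! (i - 1)) = Some (c p ! (i - 1))"
      by (rule section_eval [OF t _ c [OF one] _ c [OF p]])
        (use \<open>k + 2 \<le> n\<close> i t1 S.IG_eval_gen [OF e] fix_ran set_c [OF one] in auto)
    moreover have "c q ! (i - 1) = \<alpha> (inv' q i)" for q using i by (auto simp: c_def nth_upt simp del: upt_Suc)
    ultimately show ?thesis by simp
  qed
  have mult: "t (c p) \<cdot>\<^bsub>IG (PT n)\<^esub> t (c q) = t (c (p \<circ> q))"
    if p: "p \<in> carrier (sym_group k)" and q: "q \<in> carrier (sym_group k)" for p q
  proof -
    let ?f = "IG_eval (PT n) (t (c q))"
    have f: "?f (\<alpha> i) = Some (\<alpha> (inv' q i))" "inv' q i \<in> {1..k}" if "i \<in> {1..k}" for i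
      using ev [OF q] permutes_in_image [OF perm [OF q]] that by auto
    have ran_\<alpha>: "ran e = \<alpha> ` {1..k}" using \<alpha> by (simp add: bij_betw_def)
    have "set (c p) \<subseteq> dom ?f" unfolding set_c [OF p] ran_\<alpha> using f by auto
    moreover have "inj_on ?f (set (c p))"
      unfolding set_c [OF p] ran_\<alpha>
    proof (rule inj_onI, elim imageE)
      fix x y i j assume "?f x = ?f y" "x = \<alpha> i" "y = \<alpha> j" and ij: "i \<in> {1..k}" "j \<in> {1..k}"
      then have "inv' q i = inv' q j" using f \<alpha>_eq by simp
      then have "i = j" using permutes_inj [OF perm [OF q]] by (simp add: inj_eq)
      then show "x = y" using \<open>x = \<alpha> i\<close> \<open>y = \<alpha> j\<close> by simp
    qed
    ultimately have "t (c p) \<cdot>\<^bsub>IG (PT n)\<^esub> t (c q) = t (map (the \<circ> ?f) (c p))"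
      by (rule section_mult [OF t c [OF p] tc [OF q]])
    also have "map (the \<circ> ?f) (c p) = c (p \<circ> q)"
    proof -
      have "map (the \<circ> ?f) (c p) = map (the \<circ> ?f) (map (\<alpha> \<circ> inv' p) [1..<Suc k])"
        by (simp only: c_def)
      moreover
      have "bij p" "bij q" using p q by (auto simp: sym_group_carrier permutes_bij)
      then have "inv' (p \<circ> q) = inv' q \<circ> inv' p" by (rule o_inv_distrib)
      moreover have "inv' p i \<in> {1..k}" if "i \<in> {1..k}" for i
        using permutes_in_image [OF perm [OF p]] that by auto
      ultimately have "map (the \<circ> ?f) (c p) = map (\<alpha> \<circ> inv' (p \<circ> q)) [1..<Suc k]"
        using f by (auto simp del: upt_Suc)
      then show ?thesis by (simp only: c_def)
    qed
    finally show ?thesis .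
  qed
  have inv_closed: "inv' p \<in> carrier (sym_group k)"
    and inv_comp: "p \<circ> inv' p = id" "inv' p \<circ> p = id" if "p \<in> carrier (sym_group k)" for p
    using that by (auto simp: sym_group_carrier permutes_inv permutes_inv_o)
  note H_iff = IG.H_class_idempotent_iff [OF S.IG_gen_idempotent [OF e]]
  have tH: "t (c p) \<in> H_class (IG (PT n)) (IG_gen (PT n) e)" if p: "p \<in> carrier (sym_group k)" for p
    unfolding H_iff unfolding t1 [symmetric]
  proof (intro conjI bexI)
    show "t (c id) \<cdot>\<^bsub>IG (PT n)\<^esub> t (c p) = t (c p)" "t (c p) \<cdot>\<^bsub>IG (PT n)\<^esub> t (c id) = t (c p)"
      using mult [OF one p] mult [OF p one] by simp_all
    show "t (c (inv' p)) \<cdot>\<^bsub>IG (PT n)\<^esub> t (c p) = t (c id)"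
      "t (c p) \<cdot>\<^bsub>IG (PT n)\<^esub> t (c (inv' p)) = t (c id)"
      using mult [OF inv_closed [OF p] p] mult [OF p inv_closed [OF p]] inv_comp [OF p] by simp_all
  qed (use tc p inv_closed in auto)
  have inj: "p = q"
    if p: "p \<in> carrier (sym_group k)" and q: "q \<in> carrier (sym_group k)" and eq: "t (c p) = t (c q)"
    for p q
  proof -
    have "inv' p i = inv' q i" for i
    proof (cases "i \<in> {1..k}")
      case True
      then show ?thesis
        using ev [OF p True] ev [OF q True] eq \<alpha>_eq permutes_in_image [OF perm [OF p]]
          permutes_in_image [OF perm [OF q]] by simp
    next
      case False
      then show ?thesis using perm p q by (metis permutes_not_in)
    qed
    then have "inv' p = inv' q" by blast
    then show ?thesis using p q by (metis permutes_inv_inv sym_group_carrier)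
  qed
  have surj: "\<exists>p \<in> carrier (sym_group k). w = t (c p)"
    if w: "w \<in> H_class (IG (PT n)) (IG_gen (PT n) e)" for w
  proof -
    obtain s where wc: "w \<in> carrier (IG (PT n))" and s: "s \<in> carrier (IG (PT n))"
      and ew: "IG_gen (PT n) e \<cdot>\<^bsub>IG (PT n)\<^esub> w = w" and we: "w \<cdot>\<^bsub>IG (PT n)\<^esub> IG_gen (PT n) e = w"
      and ws: "w \<cdot>\<^bsub>IG (PT n)\<^esub> s = IG_gen (PT n) e"
      using w unfolding H_iff by blast
    let ?f = "IG_eval (PT n) w"
    \<comment> \<open>Having a right inverse makes \<open>?f\<close> defined and injective on the image of \<open>e\<close>; being fixed
      by \<open>e\<close> on the right confines its image to that of \<open>e\<close>.\<close>
    have fs: "IG_eval (PT n) s \<circ>\<^sub>m ?f = e"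
      using S.IG_eval_sprod [OF wc s] ws S.IG_eval_gen [OF e] by (simp add: PT_sprod)
    have fe: "e \<circ>\<^sub>m ?f = ?f"
      using S.IG_eval_sprod [OF wc S.IG_gen_closed [OF e]] we S.IG_eval_gen [OF e] by (simp add: PT_sprod)
    have dom: "?f x \<noteq> None" if "x \<in> ran e" for x
      using fix_ran [OF that] fun_cong [OF fs, of x] by (auto simp: map_comp_def split: option.splits)
    have inj: "x = y" if "x \<in> ran e" "y \<in> ran e" "?f x = ?f y" for x y
      using fix_ran [OF that(1)] fix_ran [OF that(2)] fun_cong [OF fs, of x] fun_cong [OF fs, of y]
        that(3) by (simp add: map_comp_def)
    have ran: "y \<in> ran e" if "?f x = Some y" for x y
      using fun_cong [OF fe, of x] that by (auto simp: map_comp_def ran_def)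
    \<comment> \<open>the permutation of the labels that \<open>w\<close> induces on the image of \<open>e\<close>\<close>
    define \<sigma> where "\<sigma> i = (if i \<in> {1..k} then inv_into {1..k} \<alpha> (the (?f (\<alpha> i))) else i)" for i
    have \<sigma>: "\<sigma> i \<in> {1..k}" "?f (\<alpha> i) = Some (\<alpha> (\<sigma> i))" if i: "i \<in> {1..k}" for i
    proof -
      obtain y where y: "?f (\<alpha> i) = Some y" using dom [OF \<alpha>_ran [OF i]] by blast
      then have "y \<in> \<alpha> ` {1..k}" using ran \<alpha> by (auto simp: bij_betw_def)
      then show "\<sigma> i \<in> {1..k}" "?f (\<alpha> i) = Some (\<alpha> (\<sigma> i))"
        using y i inv_into_into [of y \<alpha> "{1..k}"] f_inv_into_f [of y \<alpha> "{1..k}"]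
        unfolding \<sigma>_def by auto
    qed
    have "\<sigma> permutes {1..k}"
    proof (rule bij_imp_permutes)
      have "inj_on \<sigma> {1..k}"
        by (rule inj_onI) (metis \<sigma>(2) inj \<alpha>_ran \<alpha>_eq)
      moreover have "\<sigma> ` {1..k} \<subseteq> {1..k}" using \<sigma>(1) by blast
      ultimately show "bij_betw \<sigma> {1..k} {1..k}"
        by (simp add: bij_betw_def endo_inj_surj)
    qed (auto simp: \<sigma>_def)
    then have p: "inv' \<sigma> \<in> carrier (sym_group k)" and inv_inv: "inv' (inv' \<sigma>) = \<sigma>"
      by (simp_all add: sym_group_carrier permutes_inv permutes_inv_inv)
    have "w = t (c id) \<cdot>\<^bsub>IG (PT n)\<^esub> w" using ew t1 by simp
    also have "\<dots> = t (map (the \<circ> ?f) (c id))"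
      by (rule section_mult [OF t c [OF one] wc])
        (use dom inj set_c [OF one] in \<open>auto simp: inj_on_def\<close>)
    also have "map (the \<circ> ?f) (c id) = c (inv' \<sigma>)"
      unfolding c_def map_map inv_inv using \<sigma>(2) by (intro map_cong) (auto simp del: upt_Suc)
    finally show ?thesis using p by blast
  qed
  let ?M = "maximal_subgroup (IG (PT n)) (IG_gen (PT n) e)"
  have "(\<lambda>p. t (c p)) \<in> iso (sym_group k) ?M"
    unfolding iso_iff
  proof (intro conjI)
    show "(\<lambda>p. t (c p)) \<in> hom (sym_group k) ?M"
      by (rule homI) (simp_all add: maximal_subgroup_def tH mult sym_group_mult)
    show "(\<lambda>p. t (c p)) ` carrier (sym_group k) = carrier ?M"
      using tH surj by (auto simp: maximal_subgroup_def)
    show "inj_on (\<lambda>p. t (c p)) (carrier (sym_group k))"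
      using inj by (rule inj_onI)
  qed
  then show ?thesis
    using group.iso_sym [OF sym_group_is_group] by (auto simp: is_iso_def)
qed

end
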